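(* Let $\alpha>0$, let $V$ satisfy the assumptions listed in the context (with parameters $d\in[1,+\infty)$, $\theta>0$), and let $\mathbb{P}_N$ be the log-gas measure defined in the context. Then the law of $\overline{x_{\max}}=\dfrac{x_{\max}}{(\theta^{-1}\log N)^{1/d}}$ under $\mathbb{P}_N$ satisfies a large deviation principle at speed $\log N$ with good rate function $I_d$, i.e.: (1) for any open set $O\subset\mathbb{R}$, $$-\inf_{x\in O}I_d(x)\le\liminf_{N\to\infty}\frac{1}{\log N}\log\mathbb{P}_N\left(\overline{x_{\max}}\in O\right);$$ (2) for any closed set $F\subset\mathbb{R}$, $$\limsup_{N\to\infty}\frac{1}{\log N}\log\mathbb{P}_N\left(\overline{x_{\max}}\in F\right)\le-\inf_{x\in F}I_d(x).$$
   Context: Assumptions on $V$: $V:\mathbb{R}\to\mathbb{R}$ is continuous and $V(x)=\theta|x|^d+\varphi(x)$ with $d\in[1,+\infty)$ real, $\theta>0$, where as $|x|\to\infty$: $\varphi(x)=o(|x|^d)$; $\varphi$ is $\mathcal{C}^2$ outside of a compact set, $\varphi'(x)=o(|x|^{d-1})$, and for any $a<b$, $\sup_{y\in[a,b]}\varphi''(x+y)=o(|x|^{d-2})$. Let $g(x)=-\log|x|$. The probability measure $\mathbb{P}_N$ on $\mathbb{R}^N$ is $$d\mathbb{P}_N(x_1,\dots,x_N)=\frac{1}{\mathcal{Z}_N}\prod_{1\le i<j\le N}e^{-\frac{2\alpha}{N}g(x_i-x_j)}\prod_{i=1}^N e^{-V(x_i)}\,dx_1\cdots dx_N,$$ where $\mathcal{Z}_N$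 is the normalization constant (finite under the assumptions). $x_{\max}=\max_{1\le i\le N}x_i$. Rate function: $I_d:\mathbb{R}\to[0,+\infty]$, $I_d(x)=x^d-1$ if $x\ge1$ and $I_d(x)=+\infty$ if $x<1$. "Good" means lower semicontinuous with compact level sets. *)

theory Defs
  imports "HOL-Probability.Probability"
begin

definition C2_outside_compact :: "(real \<Rightarrow> real) \<Rightarrow> bool" where
  "C2_outside_compact f \<longleftrightarrow>
     (\<exists>K. compact K \<and> f differentiable_on (- K) \<and> deriv f differentiable_on (- K) \<and>
          continuous_on (- K) (deriv (deriv f)))"

(* The supremum carries no absolute value. It is a supremum in the conditionally complete
   type real; for |x| large it is taken over a compact interval on which the second
   derivative is continuous, so it is a genuine supremum there. *)
definition potential_perturbation :: "real \<Rightarrow> (real \<Rightarrow> real) \<Rightarrow> bool" where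
  "potential_perturbation d \<phi> \<longleftrightarrow>
     \<phi> \<in> o[at_infinity](\<lambda>x. \<bar>x\<bar> powr d) \<and>
     C2_outside_compact \<phi> \<and>
     deriv \<phi> \<in> o[at_infinity](\<lambda>x. \<bar>x\<bar> powr (d - 1)) \<and>
     (\<forall>a b. a < b \<longrightarrow>
        (\<lambda>x. SUP y\<in>{a..b}. deriv (deriv \<phi>) (x + y)) \<in> o[at_infinity](\<lambda>x. \<bar>x\<bar> powr (d - 2)))"

definition admissible_potential :: "real \<Rightarrow> real \<Rightarrow> (real \<Rightarrow> real) \<Rightarrow> bool" where
  "admissible_potential d \<theta> V \<longleftrightarrow>
     1 \<le> d \<and> 0 < \<theta> \<and> continuous_on UNIV V \<and>
     (\<exists>\<phi>. (\<forall>x. V x = \<theta> * \<bar>x\<bar> powr d + \<phi> x) \<and> potential_perturbation d \<phi>)"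

(* The value at 0, where the mathematical kernel is infinite and ln 0 = 0 here, only affects
   configurations with two equal coordinates, a null set of Lebesgue measure. *)
definition log_kernel :: "real \<Rightarrow> real" where
  "log_kernel x = - ln \<bar>x\<bar>"

definition log_gas_weight :: "real \<Rightarrow> (real \<Rightarrow> real) \<Rightarrow> nat \<Rightarrow> (nat \<Rightarrow> real) \<Rightarrow> real" where
  "log_gas_weight \<alpha> V N x =
     (\<Prod>j\<in>{1..N}. \<Prod>i\<in>{1..<j}. exp (- (2 * \<alpha> / real N) * log_kernel (x i - x j))) *
     (\<Prod>i\<in>{1..N}. exp (- V (x i)))"

(* Lebesgue measure on configurations indexed by {1..N}; these are functions on nat that are
   undefined outside {1..N}. *)
definition config_lebesgue :: "nat \<Rightarrow> (nat \<Rightarrow> real) measure" where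
  "config_lebesgue N = PiM {1..N} (\<lambda>_. lborel)"

definition partition_function :: "real \<Rightarrow> (real \<Rightarrow> real) \<Rightarrow> nat \<Rightarrow> ennreal" where
  "partition_function \<alpha> V N = (\<integral>\<^sup>+x. ennreal (log_gas_weight \<alpha> V N x) \<partial>config_lebesgue N)"

definition log_gas :: "real \<Rightarrow> (real \<Rightarrow> real) \<Rightarrow> nat \<Rightarrow> (nat \<Rightarrow> real) measure" where
  "log_gas \<alpha> V N =
     density (config_lebesgue N)
       (\<lambda>x. ennreal (log_gas_weight \<alpha> V N x) / partition_function \<alpha> V N)"

definition x_max :: "nat \<Rightarrow> (nat \<Rightarrow> real) \<Rightarrow> real" where
  "x_max N x = Max (x ` {1..N})"

definition scaled_x_max :: "real \<Rightarrow> real \<Rightarrow> nat \<Rightarrow> (nat \<Rightarrow> real) \<Rightarrow> real" where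
  "scaled_x_max d \<theta> N x = x_max N x / (ln (real N) / \<theta>) powr (1 / d)"

definition scaled_x_max_law ::
    "real \<Rightarrow> real \<Rightarrow> real \<Rightarrow> (real \<Rightarrow> real) \<Rightarrow> nat \<Rightarrow> real measure" where
  "scaled_x_max_law d \<theta> \<alpha> V N = distr (log_gas \<alpha> V N) borel (scaled_x_max d \<theta> N)"

definition rate_I :: "real \<Rightarrow> real \<Rightarrow> ereal" where
  "rate_I d x = (if 1 \<le> x then ereal (x powr d - 1) else \<infinity>)"

(* Logarithm of a probability, with log 0 = - infinity. *)
definition log_prob :: "real \<Rightarrow> ereal" where
  "log_prob p = (if p = 0 then - \<infinity> else ereal (ln p))"

definition good_rate_function :: "('a::topological_space \<Rightarrow> ereal) \<Rightarrow> bool" where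
  "good_rate_function I \<longleftrightarrow>
     (\<forall>x. 0 \<le> I x) \<and>
     (\<forall>x. I x \<le> Liminf (at x) I) \<and>
     (\<forall>c::real. compact {x. I x \<le> ereal c})"

(* Infima are taken in ereal, so that the infimum over the empty set is + infinity. *)
definition large_deviation_principle ::
    "(nat \<Rightarrow> 'a::topological_space measure) \<Rightarrow> (nat \<Rightarrow> real) \<Rightarrow> ('a \<Rightarrow> ereal) \<Rightarrow> bool" where
  "large_deviation_principle \<mu> s I \<longleftrightarrow>
     (\<forall>U. open U \<longrightarrow>
        - (INF x\<in>U. I x) \<le> liminf (\<lambda>N. ereal (1 / s N) * log_prob (measure (\<mu> N) U))) \<and>
     (\<forall>F. closed F \<longrightarrow>
        limsup (\<lambda>N. ereal (1 / s N) * log_prob (measure (\<mu> N) F)) \<le> - (INF x\<in>F. I x))"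

end

theory Submission
  imports Defs "HOL-Real_Asymp.Real_Asymp"
begin

text \<open>Write \<open>Z\<^sub>n S\<close> for the partition function of
  \<open>n\<close> particles confined to \<open>S\<close>, always with pair exponent \<open>\<beta> = 2 * \<alpha> / N\<close>. Since
  \<open>\<beta> * n\<close> stays bounded, adding one particle changes \<open>Z\<^sub>n S\<close> by at most a constant factor, from
  above and from below, uniformly in \<open>n < N\<close> and in \<open>S \<supseteq> {0..1}\<close>.
  Removing a particle that sits above \<open>t\<close> therefore gives
  \<open>P(x_max \<ge> t) \<le> N * const * \<integral>\<^sub>t\<^sup>\<infinity> (1 + y) powr (2 * \<alpha>) * exp (- V y)\<close>. Conversely, pushing any one of the
  \<open>N\<close> particles of a configuration below \<open>t\<close> into \<open>{t+1..t+2}\<close>, at distance at least 1 from all the others,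
  gives \<open>P(t < x_max \<le> t + 2) \<ge> N * const * exp (- sup V) * P(x_max \<le> t)\<close>.
  The latter inequality yields the lower bound and, iterated, the superpolynomial decay of
  \<open>P(x_max \<le> b * R\<^sub>N)\<close> for \<open>b < 1\<close>, where \<open>R\<^sub>N = (ln N / \<theta>) powr (1 / d)\<close>.\<close>

section \<open>Weights of particle configurations\<close>

text \<open>The index set is arbitrary so that single particles can be removed or added, and the
  one-particle factor \<open>w\<close> is arbitrary so that confinement to a set becomes
  multiplication of \<open>w\<close> by an indicator.\<close>

definition gas_weight :: "real \<Rightarrow> (real \<Rightarrow> real) \<Rightarrow> nat set \<Rightarrow> (nat \<Rightarrow> real) \<Rightarrow> real" where
  "gas_weight \<beta> w I x =
     (\<Prod>j\<in>I. \<Prod>i\<in>{i\<in>I. i < j}. exp (\<beta> * ln \<bar>x i - x j\<bar>)) * (\<Prod>i\<in>I. w (x i))"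

text \<open>Since \<open>k\<close> need not be the largest index, its pairs arise in two places:
  with \<open>k\<close> as the outer index and \<open>i < k\<close>, and with \<open>k\<close> as
  the inner index and \<open>k < j\<close>. Symmetry of the distance merges them into one product
  over \<open>I\<close>.\<close>

lemma gas_weight_insert:
  assumes "finite I" "k \<notin> I"
  shows "gas_weight \<beta> w (insert k I) x =
    gas_weight \<beta> w I x * (w (x k) * (\<Prod>i\<in>I. exp (\<beta> * ln \<bar>x i - x k\<bar>)))"
proof -
  let ?g = "\<lambda>i j. exp (\<beta> * ln \<bar>x i - x j\<bar>)"
  have sym: "?g i j = ?g j i" for i j by (simp add: abs_minus_commute)
  have k: "{i \<in> insert k I. i < k} = {i \<in> I. i < k}" by auto
  have "(\<Prod>j\<in>I. \<Prod>i\<in>{i\<in>insert k I. i < j}. ?g i j)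
      = (\<Prod>j\<in>I. (if k < j then ?g j k else 1) * (\<Prod>i\<in>{i\<in>I. i < j}. ?g i j))"
  proof (rule prod.cong[OF refl])
    fix j assume "j \<in> I"
    have "{i\<in>insert k I. i < j} = (if k < j then insert k {i\<in>I. i < j} else {i\<in>I. i < j})"
      by auto
    then show "(\<Prod>i\<in>{i\<in>insert k I. i < j}. ?g i j)
      = (if k < j then ?g j k else 1) * (\<Prod>i\<in>{i\<in>I. i < j}. ?g i j)"
      using assms sym[of k j] by simp
  qed
  also have "\<dots> = (\<Prod>j\<in>{j\<in>I. k < j}. ?g j k) * (\<Prod>j\<in>I. \<Prod>i\<in>{i\<in>I. i < j}. ?g i j)"
    using assms by (simp add: prod.distrib prod.inter_filter)
  finally have 1: "(\<Prod>j\<in>I. \<Prod>i\<in>{i\<in>insert k I. i < j}. ?g i j)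
    = (\<Prod>j\<in>{j\<in>I. k < j}. ?g j k) * (\<Prod>j\<in>I. \<Prod>i\<in>{i\<in>I. i < j}. ?g i j)" .
  have "I = {i\<in>I. i < k} \<union> {i\<in>I. k < i}"
    using assms(2) by auto (metis linorder_neqE_nat)
  then have "(\<Prod>i\<in>I. ?g i k) = (\<Prod>i\<in>{i\<in>I. i < k} \<union> {i\<in>I. k < i}. ?g i k)"
    by simp
  also have "\<dots> = (\<Prod>i\<in>{i\<in>I. i < k}. ?g i k) * (\<Prod>i\<in>{i\<in>I. k < i}. ?g i k)"
    using assms by (intro prod.union_disjoint) auto
  finally have 2: "(\<Prod>i\<in>I. ?g i k) = (\<Prod>i\<in>{i\<in>I. i < k}. ?g i k) * (\<Prod>i\<in>{i\<in>I. k < i}. ?g i k)" .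
  show ?thesis
    unfolding gas_weight_def prod.insert[OF assms] 1 2 k by (simp only: mult_ac)
qed

lemma gas_weight_cong:
  assumes "\<And>i. i \<in> I \<Longrightarrow> x i = y i"
  shows "gas_weight \<beta> w I x = gas_weight \<beta> w I y"
  unfolding gas_weight_def using assms by (intro arg_cong2[where f="(*)"] prod.cong) auto

text \<open>Evaluation at \<open>x(k := y)\<close> is the form in which the product integral over
  \<open>insert k I\<close> splits off the coordinate \<open>k\<close>.\<close>

lemma gas_weight_insert_upd:
  assumes "finite I" "k \<notin> I"
  shows "gas_weight \<beta> w (insert k I) (x(k := y)) =
    gas_weight \<beta> w I x * (w y * (\<Prod>i\<in>I. exp (\<beta> * ln \<bar>x i - y\<bar>)))"
proof -
  have "gas_weight \<beta> w I (x(k := y)) = gas_weight \<beta> w I x"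
    using assms by (intro gas_weight_cong) auto
  moreover have "(\<Prod>i\<in>I. exp (\<beta> * ln \<bar>(x(k := y)) i - y\<bar>)) = (\<Prod>i\<in>I. exp (\<beta> * ln \<bar>x i - y\<bar>))"
    using assms by (intro prod.cong) auto
  ultimately show ?thesis by (simp add: gas_weight_insert[OF assms])
qed

lemma gas_weight_nonneg: "(\<And>y. 0 \<le> w y) \<Longrightarrow> 0 \<le> gas_weight \<beta> w I x"
  by (simp add: gas_weight_def prod_nonneg)

lemma gas_weight_indicator:
  assumes "finite I"
  shows "gas_weight \<beta> (\<lambda>y. w y * indicator S y) I x = gas_weight \<beta> w I x * indicator {x. \<forall>i\<in>I. x i \<in> S} x"
proof -
  have "(\<Prod>i\<in>I. indicator S (x i)) = (indicator {x. \<forall>i\<in>I. x i \<in> S} x :: real)"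
    using assms by (induction I) (auto simp: indicator_def)
  then show ?thesis by (simp add: gas_weight_def prod.distrib)
qed

lemma gas_weight_measurable [measurable]:
  assumes "finite I" and [measurable]: "w \<in> borel_measurable borel"
  shows "gas_weight \<beta> w I \<in> borel_measurable (PiM I (\<lambda>_. lborel))"
proof -
  have [measurable]: "(\<lambda>x. x i) \<in> borel_measurable (PiM I (\<lambda>_. lborel))" if "i \<in> I" for i
    using measurable_component_singleton[OF that, of "\<lambda>_. lborel"] by simp
  have "(\<lambda>x. \<Prod>j\<in>I. \<Prod>i\<in>{i\<in>I. i < j}. exp (\<beta> * ln \<bar>x i - x j\<bar>)) \<in> borel_measurable (PiM I (\<lambda>_. lborel))"
    by (intro borel_measurable_prod) (auto intro!: borel_measurable_exp borel_measurable_times borel_measurable_ln borel_measurable_abs borel_measurable_diff)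
  moreover have "(\<lambda>x. \<Prod>i\<in>I. w (x i)) \<in> borel_measurable (PiM I (\<lambda>_. lborel))"
    by (intro borel_measurable_prod) measurable
  ultimately show ?thesis
    unfolding gas_weight_def by measurable
qed

section \<open>Domination of the interaction by one-particle factors\<close>

lemma exp_ln_dist_le:
  fixes x y \<beta> :: real
  assumes "0 \<le> \<beta>"
  shows "exp (\<beta> * ln \<bar>x - y\<bar>) \<le> (1 + \<bar>x\<bar>) powr \<beta> * (1 + \<bar>y\<bar>) powr \<beta>"
proof -
  have "\<bar>x - y\<bar> \<le> 1 + \<bar>x\<bar> + \<bar>y\<bar> + \<bar>x\<bar> * \<bar>y\<bar>"
    using abs_triangle_ineq4[of x y] abs_ge_zero[of "x*y"] unfolding abs_mult by linarith
  also have "\<dots> = (1 + \<bar>x\<bar>) * (1 + \<bar>y\<bar>)" by (simp add: algebra_simps)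
  finally have "\<bar>x - y\<bar> \<le> (1 + \<bar>x\<bar>) * (1 + \<bar>y\<bar>)" .
  \<comment> \<open>This bound covers \<open>x = y\<close>, where \<open>ln 0 = 0\<close> makes the
    pair factor equal to 1.\<close>
  moreover have "1 \<le> (1 + \<bar>x\<bar>) * (1 + \<bar>y\<bar>)"
    using mult_mono[of 1 "1+\<bar>x\<bar>" 1 "1+\<bar>y\<bar>"] by simp
  ultimately have "ln \<bar>x - y\<bar> \<le> ln ((1 + \<bar>x\<bar>) * (1 + \<bar>y\<bar>))"
    by (cases "x = y") (simp_all)
  then have "\<beta> * ln \<bar>x - y\<bar> \<le> \<beta> * ln (1 + \<bar>x\<bar>) + \<beta> * ln (1 + \<bar>y\<bar>)"
    using mult_left_mono[OF _ assms]
    by (metis abs_ge_zero add_pos_nonneg distrib_left ln_mult_pos zero_less_one)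
  then have "exp (\<beta> * ln \<bar>x - y\<bar>) \<le> exp (\<beta> * ln (1 + \<bar>x\<bar>) + \<beta> * ln (1 + \<bar>y\<bar>))" by simp
  moreover have "1 + \<bar>x\<bar> \<noteq> 0" "1 + \<bar>y\<bar> \<noteq> 0" by linarith+
  ultimately show ?thesis by (simp add: powr_def exp_add)
qed

text \<open>Each pair factor is split between its two particles by \<open>exp_ln_dist_le\<close>, so
  the majorant factorises over the particles. A particle meets only \<open>card I - 1\<close>
  others; the exponent is rounded up to \<open>\<beta> * card I\<close>.\<close>

lemma gas_weight_le:
  assumes "finite I" "0 \<le> \<beta>" "\<And>y. 0 \<le> w y"
  shows "gas_weight \<beta> w I x \<le> (\<Prod>i\<in>I. w (x i) * (1 + \<bar>x i\<bar>) powr (\<beta> * card I))"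
  using assms(1)
proof (induction I)
  case empty
  then show ?case by (simp add: gas_weight_def)
next
  case (insert k I)
  let ?n = "real (card I)"
  have "gas_weight \<beta> w (insert k I) x
      = gas_weight \<beta> w I x * (w (x k) * (\<Prod>i\<in>I. exp (\<beta> * ln \<bar>x i - x k\<bar>)))"
    using insert by (simp add: gas_weight_insert)
  also have "\<dots> \<le> (\<Prod>i\<in>I. w (x i) * (1 + \<bar>x i\<bar>) powr (\<beta> * card I)) *
      (w (x k) * (\<Prod>i\<in>I. (1 + \<bar>x i\<bar>) powr \<beta> * (1 + \<bar>x k\<bar>) powr \<beta>))"
    using assms insert
    by (intro mult_mono mult_left_mono prod_mono conjI exp_ln_dist_le insert.IH)
       (auto intro!: prod_nonneg mult_nonneg_nonneg gas_weight_nonneg)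
  also have "\<dots> = (\<Prod>i\<in>I. w (x i) * (1 + \<bar>x i\<bar>) powr (\<beta> * (?n + 1))) * (w (x k) * (1 + \<bar>x k\<bar>) powr (\<beta> * ?n))"
    by (simp add: prod.distrib powr_add distrib_left powr_power mult_ac)
  also have "\<dots> \<le> (\<Prod>i\<in>I. w (x i) * (1 + \<bar>x i\<bar>) powr (\<beta> * (?n + 1))) * (w (x k) * (1 + \<bar>x k\<bar>) powr (\<beta> * (?n + 1)))"
    using assms by (intro mult_left_mono powr_mono) (auto intro!: prod_nonneg mult_left_mono)
  finally show ?case using insert by (simp add: add.commute mult.commute)
qed

section \<open>Adding one particle\<close>

interpretation lborel_prod: product_sigma_finite "\<lambda>_::nat. lborel :: real measure"
  by standard

section \<open>The integrable singularity of the logarithm\<close>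

definition log_minus :: "real \<Rightarrow> real" where
  "log_minus z = max 0 (- ln \<bar>z\<bar>)"

lemma log_minus_nonneg: "0 \<le> log_minus z"
  by (simp add: log_minus_def)

lemma log_minus_measurable [measurable]: "log_minus \<in> borel_measurable borel"
  unfolding log_minus_def by measurable

text \<open>For \<open>|z| \<le> 1\<close>, \<open>- ln |z| = 2 * ln (|z| powr (-1/2))\<close> is at
  most \<open>2 * |z| powr (-1/2)\<close>, whose integral over \<open>{0..1}\<close> is 4; the two
  signs of \<open>z\<close> together give 8.\<close>

lemma nn_integral_log_minus_le: "(\<integral>\<^sup>+z. ennreal (log_minus z) \<partial>lborel) \<le> 8"
proof -
  define h where "h z = ennreal (2 * z powr (-1/2)) * indicator {0..1} z" for z :: real
  have [measurable]: "h \<in> borel_measurable borel"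
    unfolding h_def by measurable
  have le: "log_minus z \<le> 2 * \<bar>z\<bar> powr (-1/2)" if "\<bar>z\<bar> \<le> 1" for z
  proof (cases "z = 0")
    case False
    have "- ln \<bar>z\<bar> = 2 * ln (\<bar>z\<bar> powr (-1/2))"
      using False by (simp add: ln_powr)
    also have "\<dots> \<le> 2 * (\<bar>z\<bar> powr (-1/2))"
      using False ln_bound[of "\<bar>z\<bar> powr (-1/2)"] by simp
    finally show ?thesis by (simp add: log_minus_def)
  qed (simp add: log_minus_def)
  have "ennreal (log_minus z) \<le> h z + h (-z)" for z
  proof (cases "\<bar>z\<bar> \<le> 1")
    case True
    then have "ennreal (log_minus z) \<le> ennreal (2 * \<bar>z\<bar> powr (-1/2))"
      by (intro ennreal_leI le)
    also have "\<dots> \<le> h z + h (-z)"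
      using True by (cases "0 \<le> z") (auto simp: h_def)
    finally show ?thesis .
  next
    case False
    then show ?thesis by (simp add: log_minus_def)
  qed
  then have "(\<integral>\<^sup>+z. ennreal (log_minus z) \<partial>lborel) \<le> (\<integral>\<^sup>+z. h z + h (-z) \<partial>lborel)"
    by (intro nn_integral_mono)
  also have "\<dots> = (\<integral>\<^sup>+z. h z \<partial>lborel) + (\<integral>\<^sup>+z. h (-z) \<partial>lborel)"
    by (intro nn_integral_add) auto
  also have "(\<integral>\<^sup>+z. h (-z) \<partial>lborel) = (\<integral>\<^sup>+z. h z \<partial>lborel)"
    using nn_integral_real_affine[of h "-1" 0] by simp
  also have "(\<integral>\<^sup>+z. h z \<partial>lborel) = 4"
  proof -
    have "((\<lambda>z::real. 2 * z powr (-1/2)) has_integral 2 * (1 powr (-1/2+1) / (-1/2+1))) {0..1}"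
      by (intro has_integral_mult_right has_integral_powr_from_0) auto
    then have "((\<lambda>z::real. if z \<in> {0..1} then 2 * z powr (-1/2) else 0) has_integral 4) UNIV"
      by (simp only: has_integral_restrict_UNIV) simp
    also have "(\<lambda>z::real. if z \<in> {0..1} then 2 * z powr (-1/2) else 0) = (\<lambda>z. 2 * z powr (-1/2) * indicator {0..1} z)"
      by (auto simp: indicator_def)
    finally have "((\<lambda>z::real. 2 * z powr (-1/2) * indicator {0..1} z) has_integral 4) UNIV" .
    then have "(\<integral>\<^sup>+z. ennreal (2 * z powr (-1/2) * indicator {0..1} z) \<partial>lborel) = ennreal 4"
      by (intro nn_integral_has_integral_lborel) auto
    then show ?thesis
      unfolding h_def by (simp add: ennreal_mult' ennreal_indicator)
  qed
  finally show ?thesis by simp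
qed

lemma nn_integral_log_minus_translate: "(\<integral>\<^sup>+y. ennreal (log_minus (x - y)) \<partial>lborel) \<le> 8"
  using nn_integral_real_affine[of "\<lambda>z. ennreal (log_minus z)" "-1" x] nn_integral_log_minus_le
  by simp

lemma exp_ln_ge_log_minus:
  assumes "0 \<le> \<beta>"
  shows "exp (- (\<beta> * log_minus z)) \<le> exp (\<beta> * ln \<bar>z\<bar>)"
  using mult_left_mono[of "- ln \<bar>z\<bar>" "log_minus z" \<beta>] assms by (simp add: log_minus_def)

text \<open>Jensen's inequality for the exponential, through its tangent at the mean.\<close>

lemma nn_integral_log_interaction_ge:
  fixes x :: "nat \<Rightarrow> real" and \<beta> a :: real
  assumes "finite I" "0 \<le> \<beta>" "\<beta> * card I \<le> a"
  shows "ennreal (exp (- (8 * a))) \<le>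
    (\<integral>\<^sup>+y. ennreal (\<Prod>i\<in>I. exp (\<beta> * ln \<bar>x i - y\<bar>)) * indicator {0..1} y \<partial>lborel)"
proof -
  define s where "s y = \<beta> * (\<Sum>i\<in>I. log_minus (x i - y))" for y
  \<comment> \<open>\<open>m\<close> bounds the mean of \<open>s\<close> over \<open>{0..1}\<close>
    from above: each of the \<open>card I\<close> singularities contributes at most 8, and
    \<open>\<beta> * card I\<close> is at most \<open>a\<close>.\<close>
  define m where "m = 8 * a"
  have a: "0 \<le> a" using order_trans[OF mult_nonneg_nonneg[OF assms(2) of_nat_0_le_iff] assms(3)] .
  then have m: "0 \<le> m" by (simp add: m_def)
  have s0: "0 \<le> s y" for y
    using assms by (simp add: s_def sum_nonneg log_minus_nonneg)
  have [measurable]: "s \<in> borel_measurable borel"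
    unfolding s_def by measurable
  let ?A = "\<integral>\<^sup>+y. ennreal (\<Prod>i\<in>I. exp (\<beta> * ln \<bar>x i - y\<bar>)) * indicator {0..1} y \<partial>lborel"
  have "(\<integral>\<^sup>+y. ennreal (s y) * indicator {0..1} y \<partial>lborel) \<le> (\<integral>\<^sup>+y. ennreal (s y) \<partial>lborel)"
    by (intro nn_integral_mono) (auto simp: indicator_def)
  also have "\<dots> = (\<integral>\<^sup>+y. ennreal \<beta> * (\<Sum>i\<in>I. ennreal (log_minus (x i - y))) \<partial>lborel)"
    using assms by (intro nn_integral_cong)
      (simp add: s_def ennreal_mult sum_nonneg log_minus_nonneg)
  also have "\<dots> = ennreal \<beta> * (\<Sum>i\<in>I. \<integral>\<^sup>+y. ennreal (log_minus (x i - y)) \<partial>lborel)"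
    by (simp add: nn_integral_cmult nn_integral_sum)
  also have "\<dots> \<le> ennreal \<beta> * (\<Sum>i\<in>I. 8)"
    by (intro mult_left_mono sum_mono nn_integral_log_minus_translate) auto
  also have "\<dots> = ennreal (8 * (\<beta> * card I))"
    using assms by (simp add: ennreal_mult ennreal_of_nat_eq_real_of_nat mult_ac)
  also have "\<dots> \<le> ennreal m"
    using assms by (intro ennreal_leI) (simp add: m_def)
  finally have s: "(\<integral>\<^sup>+y. ennreal (s y) * indicator {0..1} y \<partial>lborel) \<le> ennreal m" .
  \<comment> \<open>The tangent inequality \<open>exp (- s) \<ge> exp (- m) * (1 + m - s)\<close> is
    integrated with the \<open>s\<close> term moved to the other side, since \<open>ennreal\<close>
    has no negative values; the finite term \<open>exp (- m) * m\<close> is cancelled at the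
    end.\<close>
  have "ennreal (exp (- m) * (1 + m)) = (\<integral>\<^sup>+y. ennreal (exp (- m) * (1 + m)) * indicator {0..1::real} y \<partial>lborel)"
    by (simp add: nn_integral_cmult_indicator)
  also have "\<dots> \<le> (\<integral>\<^sup>+y. ennreal (\<Prod>i\<in>I. exp (\<beta> * ln \<bar>x i - y\<bar>)) * indicator {0..1} y
      + ennreal (exp (- m)) * (ennreal (s y) * indicator {0..1} y) \<partial>lborel)"
  proof (intro nn_integral_mono)
    fix y :: real
    have "exp (- s y) = (\<Prod>i\<in>I. exp (- (\<beta> * log_minus (x i - y))))"
      using assms by (simp add: s_def exp_sum sum_distrib_left flip: sum_negf)
    also have "\<dots> \<le> (\<Prod>i\<in>I. exp (\<beta> * ln \<bar>x i - y\<bar>))"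
      using assms by (intro prod_mono conjI exp_ln_ge_log_minus) auto
    finally have 1: "exp (- s y) \<le> (\<Prod>i\<in>I. exp (\<beta> * ln \<bar>x i - y\<bar>))" .
    have "exp (-m) * (1 + (m - s y)) \<le> exp (-m) * exp (m - s y)"
      by (intro mult_left_mono exp_ge_add_one_self) auto
    also have "\<dots> = exp (- s y)" by (simp flip: exp_add)
    finally have "exp (-m) * (1 + m) \<le> (\<Prod>i\<in>I. exp (\<beta> * ln \<bar>x i - y\<bar>)) + exp (-m) * s y"
      using 1 by (simp add: algebra_simps)
    then have "ennreal (exp (-m) * (1 + m)) \<le> ennreal ((\<Prod>i\<in>I. exp (\<beta> * ln \<bar>x i - y\<bar>)) + exp (-m) * s y)"
      by (rule ennreal_leI)
    also have "\<dots> = ennreal (\<Prod>i\<in>I. exp (\<beta> * ln \<bar>x i - y\<bar>)) + ennreal (exp (- m)) * ennreal (s y)"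
      using s0 by (simp add: ennreal_mult prod_nonneg)
    finally show "ennreal (exp (- m) * (1 + m)) * indicator {0..1::real} y \<le>
       ennreal (\<Prod>i\<in>I. exp (\<beta> * ln \<bar>x i - y\<bar>)) * indicator {0..1} y
      + ennreal (exp (- m)) * (ennreal (s y) * indicator {0..1} y)"
      by (auto simp: indicator_def)
  qed
  also have "\<dots> = ?A + ennreal (exp (- m)) * (\<integral>\<^sup>+y. ennreal (s y) * indicator {0..1} y \<partial>lborel)"
    by (subst nn_integral_add) (auto simp: nn_integral_cmult)
  also have "\<dots> \<le> ?A + ennreal (exp (- m)) * ennreal m"
    using s by (intro add_left_mono mult_left_mono) auto
  finally have "ennreal (exp (- m)) + ennreal (exp (- m) * m) \<le> ?A + ennreal (exp (- m) * m)"
    using m by (simp add: distrib_left flip: ennreal_mult ennreal_plus)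
  then have "ennreal (exp (- m)) \<le> ?A"
    unfolding add.commute[of _ "ennreal (exp (- m) * m)"] ennreal_add_left_cancel_le by simp
  then show ?thesis by (simp add: m_def)
qed

text \<open>The parameter \<open>a\<close> will bound \<beta> times the number of particles. In the
  moment, the exponent \<open>a\<close> absorbs the interaction with all other particles, and the
  extra 1 pays for a factor \<open>1 + |y|\<close> per particle. No constant refers to the number of
  particles, so the resulting bounds are uniform in it.\<close>

locale gas_weight_bounds =
  fixes w :: "real \<Rightarrow> real" and a \<beta> c C :: real
  assumes w_nonneg: "\<And>y. 0 \<le> w y"
    and w_measurable [measurable]: "w \<in> borel_measurable borel"
    and w_ge: "\<And>y. 0 \<le> y \<Longrightarrow> y \<le> 1 \<Longrightarrow> c \<le> w y"
    and w_moment: "(\<integral>\<^sup>+y. ennreal (w y * (1 + \<bar>y\<bar>) powr (a + 1)) \<partial>lborel) \<le> ennreal C"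
    and c_pos: "0 < c" and C_pos: "0 < C"
    and \<beta>: "0 \<le> \<beta>" "\<beta> \<le> 1"
begin

section \<open>Two-sided bounds for the effect of one additional particle\<close>

definition Z :: "nat set \<Rightarrow> ennreal" where
  "Z I = (\<integral>\<^sup>+x. ennreal (gas_weight \<beta> w I x) \<partial>PiM I (\<lambda>_. lborel))"

abbreviation "c0 \<equiv> c * exp (- (8 * a))"

lemma c0_pos: "0 < c0" using c_pos by simp

text \<open>The new particle is restricted to \<open>{0..1}\<close>, where \<open>w\<close> is at
  least \<open>c\<close>; there the integrated interaction is at least
  \<open>exp (- (8 * a))\<close> wherever the other particles are.\<close>

lemma Z_insert_ge:
  assumes "finite I" "k \<notin> I" "\<beta> * card I \<le> a"
  shows "ennreal c0 * Z I \<le> Z (insert k I)"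
proof -
  have "ennreal c0 * Z I = (\<integral>\<^sup>+x. ennreal (gas_weight \<beta> w I x) * ennreal c0 \<partial>PiM I (\<lambda>_. lborel))"
    unfolding Z_def using assms by (subst mult.commute) (simp add: nn_integral_multc)
  also have "\<dots> \<le> (\<integral>\<^sup>+x. (\<integral>\<^sup>+y. ennreal (gas_weight \<beta> w (insert k I) (x(k := y))) \<partial>lborel) \<partial>PiM I (\<lambda>_. lborel))"
  proof (intro nn_integral_mono)
    fix x :: "nat \<Rightarrow> real"
    let ?p = "\<lambda>y. \<Prod>i\<in>I. exp (\<beta> * ln \<bar>x i - y\<bar>)"
    have "ennreal c0 = ennreal c * ennreal (exp (- (8 * a)))"
      using c_pos by (simp add: ennreal_mult)
    also have "\<dots> \<le> ennreal c * (\<integral>\<^sup>+y. ennreal (?p y) * indicator {0..1} y \<partial>lborel)"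
      using assms \<beta> by (intro mult_left_mono nn_integral_log_interaction_ge) auto
    also have "\<dots> = (\<integral>\<^sup>+y. ennreal c * (ennreal (?p y) * indicator {0..1} y) \<partial>lborel)"
      by (simp add: nn_integral_cmult)
    also have "\<dots> \<le> (\<integral>\<^sup>+y. ennreal (w y * ?p y) \<partial>lborel)"
      using w_ge w_nonneg by (intro nn_integral_mono)
        (auto simp: indicator_def ennreal_mult prod_nonneg intro!: mult_right_mono ennreal_leI)
    finally have "ennreal (gas_weight \<beta> w I x) * ennreal c0 \<le>
        ennreal (gas_weight \<beta> w I x) * (\<integral>\<^sup>+y. ennreal (w y * ?p y) \<partial>lborel)"
      by (intro mult_left_mono) auto
    also have "\<dots> = (\<integral>\<^sup>+y. ennreal (gas_weight \<beta> w (insert k I) (x(k := y))) \<partial>lborel)"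
      using assms w_nonneg
      by (simp add: gas_weight_insert_upd ennreal_mult gas_weight_nonneg prod_nonneg nn_integral_cmult)
    finally show "ennreal (gas_weight \<beta> w I x) * ennreal c0 \<le>
      (\<integral>\<^sup>+y. ennreal (gas_weight \<beta> w (insert k I) (x(k := y))) \<partial>lborel)" .
  qed
  also have "\<dots> = Z (insert k I)"
    unfolding Z_def using assms by (subst lborel_prod.product_nn_integral_insert) auto
  finally show ?thesis .
qed

lemma Z_empty: "Z {} = 1"
  by (simp add: Z_def gas_weight_def PiM_empty nn_integral_count_space_finite)

text \<open>The insertion bound is iterated from the empty configuration. Dividing by this lower
  bound turns the unnormalised moment \<open>C ^ card I\<close> into a mean of exponential
  size.\<close>

lemma Z_ge_power:
  assumes "finite I" "\<beta> * card I \<le> a"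
  shows "ennreal (c0 ^ card I) \<le> Z I"
  using assms
proof (induction I)
  case empty
  then show ?case by (simp add: Z_empty)
next
  case (insert k I)
  have "\<beta> * card I \<le> \<beta> * card (insert k I)"
    using insert \<beta> by (intro mult_left_mono) auto
  then have le: "\<beta> * card I \<le> a" using insert by linarith
  have "ennreal (c0 ^ card (insert k I)) = ennreal c0 * ennreal (c0 ^ card I)"
    using insert c0_pos by (simp add: ennreal_mult)
  also have "\<dots> \<le> ennreal c0 * Z I"
    using insert le by (intro mult_left_mono) auto
  also have "\<dots> \<le> Z (insert k I)"
    using insert le by (intro Z_insert_ge) auto
  finally show ?case .
qed

text \<open>After \<open>gas_weight_le\<close> the integrand factorises, and each factor is
  controlled by \<open>w_moment\<close>, whose exponent \<open>a + 1\<close> leaves room for the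
  factor \<open>1 + |x i|\<close>.\<close>

lemma nn_integral_gas_weight_prod_le:
  assumes "finite I" "\<beta> * card I \<le> a"
  shows "(\<integral>\<^sup>+x. ennreal (gas_weight \<beta> w I x * (\<Prod>i\<in>I. 1 + \<bar>x i\<bar>)) \<partial>PiM I (\<lambda>_. lborel)) \<le> ennreal (C ^ card I)"
proof -
  have "(\<integral>\<^sup>+x. ennreal (gas_weight \<beta> w I x * (\<Prod>i\<in>I. 1 + \<bar>x i\<bar>)) \<partial>PiM I (\<lambda>_. lborel))
     \<le> (\<integral>\<^sup>+x. (\<Prod>i\<in>I. ennreal (w (x i) * (1 + \<bar>x i\<bar>) powr (a + 1))) \<partial>PiM I (\<lambda>_. lborel))"
  proof (intro nn_integral_mono)
    fix x :: "nat \<Rightarrow> real"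
    have "gas_weight \<beta> w I x * (\<Prod>i\<in>I. 1 + \<bar>x i\<bar>)
        \<le> (\<Prod>i\<in>I. w (x i) * (1 + \<bar>x i\<bar>) powr (\<beta> * card I)) * (\<Prod>i\<in>I. 1 + \<bar>x i\<bar>)"
      using assms \<beta> w_nonneg by (intro mult_right_mono gas_weight_le prod_nonneg) auto
    also have "\<dots> = (\<Prod>i\<in>I. w (x i) * ((1 + \<bar>x i\<bar>) powr (\<beta> * card I) * (1 + \<bar>x i\<bar>)))"
      by (simp add: prod.distrib mult_ac)
    also have "\<dots> \<le> (\<Prod>i\<in>I. w (x i) * (1 + \<bar>x i\<bar>) powr (a + 1))"
      using assms w_nonneg
      by (intro prod_mono conjI mult_left_mono mult_nonneg_nonneg)
         (auto simp: powr_add intro!: mult_right_mono powr_mono)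
    finally show "ennreal (gas_weight \<beta> w I x * (\<Prod>i\<in>I. 1 + \<bar>x i\<bar>)) \<le>
       (\<Prod>i\<in>I. ennreal (w (x i) * (1 + \<bar>x i\<bar>) powr (a + 1)))"
      using w_nonneg by (subst prod_ennreal) (auto intro: ennreal_leI)
  qed
  also have "\<dots> = (\<Prod>i\<in>I. \<integral>\<^sup>+y. ennreal (w y * (1 + \<bar>y\<bar>) powr (a + 1)) \<partial>lborel)"
    using assms by (intro lborel_prod.product_nn_integral_prod) auto
  also have "\<dots> \<le> (\<Prod>i\<in>I. ennreal C)"
    using w_moment by (induction I rule: infinite_finite_induct) (auto intro: mult_mono)
  also have "\<dots> = ennreal (C ^ card I)"
    using C_pos by (simp add: ennreal_power)
  finally show ?thesis .
qed

lemma Z_finite: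
  assumes "finite I" "\<beta> * card I \<le> a"
  shows "Z I < \<infinity>"
proof -
  have "Z I \<le> (\<integral>\<^sup>+x. ennreal (gas_weight \<beta> w I x * (\<Prod>i\<in>I. 1 + \<bar>x i\<bar>)) \<partial>PiM I (\<lambda>_. lborel))"
    unfolding Z_def
  proof (intro nn_integral_mono ennreal_leI)
    fix x :: "nat \<Rightarrow> real"
    have "1 \<le> (\<Prod>i\<in>I. 1 + \<bar>x i\<bar>)" by (intro prod_ge_1) auto
    then show "gas_weight \<beta> w I x \<le> gas_weight \<beta> w I x * (\<Prod>i\<in>I. 1 + \<bar>x i\<bar>)"
      using mult_left_mono[of 1 _ "gas_weight \<beta> w I x"] gas_weight_nonneg w_nonneg by fastforce
  qed
  also have "\<dots> \<le> ennreal (C ^ card I)"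
    using assms by (rule nn_integral_gas_weight_prod_le)
  finally show ?thesis by (simp add: le_less_trans)
qed

text \<open>The mean of \<open>u = \<Prod>i. 1 + \<bar>x i\<bar>\<close> is exponential in the number of particles, and since
  \<open>\<beta>\<close> times that number stays bounded, concavity of \<open>u powr \<beta>\<close> bounds the mean of the latter by a
  constant.\<close>

lemma nn_integral_gas_weight_powr_le:
  assumes "finite I" "\<beta> * card I \<le> a" and D: "C / c0 \<le> D" "1 \<le> D"
  shows "(\<integral>\<^sup>+x. ennreal (gas_weight \<beta> w I x * (\<Prod>i\<in>I. (1 + \<bar>x i\<bar>) powr \<beta>)) \<partial>PiM I (\<lambda>_. lborel))
    \<le> ennreal (2 * D powr a) * Z I"
proof -
  \<comment> \<open>\<open>l\<close> bounds the mean of the product of the \<open>1 + |x i|\<close>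
    under the normalised weight, since \<open>(C / c0) ^ card I \<le> D ^ card I\<close>. As
    \<open>\<beta> * card I\<close> is at most \<open>a\<close>, \<open>l powr \<beta>\<close> is
    bounded independently of \<open>card I\<close>.\<close>
  define l where "l = D ^ card I"
  have l: "1 \<le> l" using D by (simp add: l_def)
  have l_le: "l powr \<beta> \<le> D powr a"
  proof -
    have "l powr \<beta> = D powr (\<beta> * card I)"
      using D by (simp add: l_def powr_powr mult.commute flip: powr_realpow)
    also have "\<dots> \<le> D powr a" using D assms by (intro powr_mono) auto
    finally show ?thesis .
  qed
  have pt: "(\<Prod>i\<in>I. (1 + \<bar>x i\<bar>) powr \<beta>) \<le> D powr a * (1 + (\<Prod>i\<in>I. 1 + \<bar>x i\<bar>) / l)" for x :: "nat \<Rightarrow> real"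
  proof -
    define u where "u = (\<Prod>i\<in>I. 1 + \<bar>x i\<bar>)"
    have u: "0 \<le> u" unfolding u_def by (intro prod_nonneg) auto
    have "(\<Prod>i\<in>I. (1 + \<bar>x i\<bar>) powr \<beta>) = u powr \<beta>"
      unfolding u_def by (subst prod_powr_distrib) auto
    also have "\<dots> = l powr \<beta> * (u / l) powr \<beta>"
      using u l by (simp add: powr_divide)
    also have "\<dots> \<le> D powr a * (1 + u / l)"
    proof (intro mult_mono l_le)
      \<comment> \<open>For an exponent between 0 and 1 the power is dominated by the affine
        function \<open>1 + u / l\<close>; this takes the place of concavity.\<close>
      have "(u / l) powr \<beta> \<le> (1 + u / l) powr \<beta>"
        using u l \<beta> by (intro powr_mono2) auto
      also have "\<dots> \<le> (1 + u / l) powr 1"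
        using u l \<beta> by (intro powr_mono) auto
      finally show "(u / l) powr \<beta> \<le> 1 + u / l" using u l by simp
    qed (use D in auto)
    finally show ?thesis by (simp add: u_def)
  qed
  have "(\<integral>\<^sup>+x. ennreal (gas_weight \<beta> w I x * (\<Prod>i\<in>I. (1 + \<bar>x i\<bar>) powr \<beta>)) \<partial>PiM I (\<lambda>_. lborel))
    \<le> (\<integral>\<^sup>+x. ennreal (D powr a) * (ennreal (gas_weight \<beta> w I x) +
         ennreal (1 / l) * ennreal (gas_weight \<beta> w I x * (\<Prod>i\<in>I. 1 + \<bar>x i\<bar>))) \<partial>PiM I (\<lambda>_. lborel))"
  proof (intro nn_integral_mono)
    fix x :: "nat \<Rightarrow> real"
    have g: "0 \<le> gas_weight \<beta> w I x" using w_nonneg by (rule gas_weight_nonneg)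
    have "gas_weight \<beta> w I x * (\<Prod>i\<in>I. (1 + \<bar>x i\<bar>) powr \<beta>)
      \<le> gas_weight \<beta> w I x * (D powr a * (1 + (\<Prod>i\<in>I. 1 + \<bar>x i\<bar>) / l))"
      using g by (intro mult_left_mono pt)
    also have "\<dots> = D powr a * (gas_weight \<beta> w I x + 1 / l * (gas_weight \<beta> w I x * (\<Prod>i\<in>I. 1 + \<bar>x i\<bar>)))"
      by (simp add: algebra_simps)
    finally have "ennreal (gas_weight \<beta> w I x * (\<Prod>i\<in>I. (1 + \<bar>x i\<bar>) powr \<beta>)) \<le> ennreal \<dots>"
      by (rule ennreal_leI)
    then show "ennreal (gas_weight \<beta> w I x * (\<Prod>i\<in>I. (1 + \<bar>x i\<bar>) powr \<beta>)) \<le>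
      ennreal (D powr a) * (ennreal (gas_weight \<beta> w I x) +
         ennreal (1 / l) * ennreal (gas_weight \<beta> w I x * (\<Prod>i\<in>I. 1 + \<bar>x i\<bar>)))"
      using g l by (simp add: prod_nonneg flip: ennreal_mult ennreal_plus)
  qed
  also have "\<dots> = ennreal (D powr a) * (Z I +
      ennreal (1 / l) * (\<integral>\<^sup>+x. ennreal (gas_weight \<beta> w I x * (\<Prod>i\<in>I. 1 + \<bar>x i\<bar>)) \<partial>PiM I (\<lambda>_. lborel)))"
  proof -
    have [measurable]: "(\<lambda>x. \<Prod>i\<in>I. 1 + \<bar>x i\<bar>) \<in> borel_measurable (PiM I (\<lambda>_. lborel :: real measure))"
      using measurable_component_singleton[of _ I "\<lambda>_. lborel"]
      by (intro borel_measurable_prod borel_measurable_add borel_measurable_abs) auto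
    show ?thesis
      unfolding Z_def using assms
      by (simp add: nn_integral_cmult nn_integral_add)
  qed
  also have "\<dots> \<le> ennreal (D powr a) * (Z I + Z I)"
  proof (intro mult_left_mono add_left_mono)
    \<comment> \<open>By the choice of \<open>l\<close> the rescaled moment is at most
      \<open>(C / D) ^ card I\<close>, hence at most \<open>c0 ^ card I\<close> and so at most
      \<open>Z I\<close>. This is the second of the two summands behind the constant 2.\<close>
    have "ennreal (1 / l) * (\<integral>\<^sup>+x. ennreal (gas_weight \<beta> w I x * (\<Prod>i\<in>I. 1 + \<bar>x i\<bar>)) \<partial>PiM I (\<lambda>_. lborel))
      \<le> ennreal (1 / l) * ennreal (C ^ card I)"
      using assms by (intro mult_left_mono nn_integral_gas_weight_prod_le) auto
    also have "\<dots> = ennreal ((C / D) ^ card I)"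
      using l C_pos by (simp add: l_def power_divide flip: ennreal_mult)
    also have "\<dots> \<le> ennreal (c0 ^ card I)"
      using D C_pos c0_pos by (intro ennreal_leI power_mono) (auto simp: field_simps)
    also have "\<dots> \<le> Z I" using assms by (intro Z_ge_power)
    finally show "ennreal (1 / l) * (\<integral>\<^sup>+x. ennreal (gas_weight \<beta> w I x * (\<Prod>i\<in>I. 1 + \<bar>x i\<bar>)) \<partial>PiM I (\<lambda>_. lborel)) \<le> Z I" .
  qed auto
  also have "\<dots> = ennreal (2 * D powr a) * Z I"
    by (simp add: ennreal_mult mult_2[symmetric] mult_ac)
  finally show ?thesis .
qed

text \<open>Upper counterpart of \<open>Z_insert_ge\<close>: the pair factors split, their part in
  \<open>y\<close> is at most \<open>(1 + |y|) powr a\<close>, and their part in \<open>x\<close> is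
  averaged by \<open>nn_integral_gas_weight_powr_le\<close>. The added particle has its own weight
  \<open>v\<close> because it may be confined to a different set than the others.\<close>

lemma nn_integral_extra_particle_le:
  assumes "finite I" "\<beta> * card I \<le> a" and D: "C / c0 \<le> D" "1 \<le> D"
    and v: "\<And>y. 0 \<le> v y" and [measurable]: "v \<in> borel_measurable borel"
  shows "(\<integral>\<^sup>+x. (\<integral>\<^sup>+y. ennreal (gas_weight \<beta> w I x * (v y * (\<Prod>i\<in>I. exp (\<beta> * ln \<bar>x i - y\<bar>)))) \<partial>lborel) \<partial>PiM I (\<lambda>_. lborel))
    \<le> ennreal (2 * D powr a) * Z I * (\<integral>\<^sup>+y. ennreal (v y * (1 + \<bar>y\<bar>) powr a) \<partial>lborel)"
proof -
  let ?J = "\<integral>\<^sup>+y. ennreal (v y * (1 + \<bar>y\<bar>) powr a) \<partial>lborel"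
  have "(\<integral>\<^sup>+x. (\<integral>\<^sup>+y. ennreal (gas_weight \<beta> w I x * (v y * (\<Prod>i\<in>I. exp (\<beta> * ln \<bar>x i - y\<bar>)))) \<partial>lborel) \<partial>PiM I (\<lambda>_. lborel))
   \<le> (\<integral>\<^sup>+x. ennreal (gas_weight \<beta> w I x * (\<Prod>i\<in>I. (1 + \<bar>x i\<bar>) powr \<beta>)) * ?J \<partial>PiM I (\<lambda>_. lborel))"
  proof (intro nn_integral_mono)
    fix x :: "nat \<Rightarrow> real"
    have g: "0 \<le> gas_weight \<beta> w I x" using w_nonneg by (rule gas_weight_nonneg)
    let ?G = "gas_weight \<beta> w I x * (\<Prod>i\<in>I. (1 + \<bar>x i\<bar>) powr \<beta>)"
    have "(\<integral>\<^sup>+y. ennreal (gas_weight \<beta> w I x * (v y * (\<Prod>i\<in>I. exp (\<beta> * ln \<bar>x i - y\<bar>)))) \<partial>lborel)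
      \<le> (\<integral>\<^sup>+y. ennreal ?G * ennreal (v y * (1 + \<bar>y\<bar>) powr a) \<partial>lborel)"
    proof (intro nn_integral_mono)
      fix y :: real
      have "(\<Prod>i\<in>I. exp (\<beta> * ln \<bar>x i - y\<bar>)) \<le> (\<Prod>i\<in>I. (1 + \<bar>x i\<bar>) powr \<beta> * (1 + \<bar>y\<bar>) powr \<beta>)"
        using \<beta> by (intro prod_mono conjI exp_ln_dist_le) auto
      also have "\<dots> = (\<Prod>i\<in>I. (1 + \<bar>x i\<bar>) powr \<beta>) * (1 + \<bar>y\<bar>) powr (\<beta> * card I)"
        by (simp add: prod.distrib powr_power mult.commute)
      also have "\<dots> \<le> (\<Prod>i\<in>I. (1 + \<bar>x i\<bar>) powr \<beta>) * (1 + \<bar>y\<bar>) powr a"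
        using assms by (intro mult_left_mono powr_mono prod_nonneg) auto
      finally have "gas_weight \<beta> w I x * (v y * (\<Prod>i\<in>I. exp (\<beta> * ln \<bar>x i - y\<bar>))) \<le>
        gas_weight \<beta> w I x * (v y * ((\<Prod>i\<in>I. (1 + \<bar>x i\<bar>) powr \<beta>) * (1 + \<bar>y\<bar>) powr a))"
        using g v by (intro mult_left_mono)
      also have "\<dots> = ?G * (v y * (1 + \<bar>y\<bar>) powr a)" by (simp add: mult_ac)
      finally have "ennreal (gas_weight \<beta> w I x * (v y * (\<Prod>i\<in>I. exp (\<beta> * ln \<bar>x i - y\<bar>)))) \<le> ennreal \<dots>"
        by (rule ennreal_leI)
      then show "ennreal (gas_weight \<beta> w I x * (v y * (\<Prod>i\<in>I. exp (\<beta> * ln \<bar>x i - y\<bar>)))) \<le>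
          ennreal ?G * ennreal (v y * (1 + \<bar>y\<bar>) powr a)"
        using g v by (simp add: prod_nonneg flip: ennreal_mult)
    qed
    also have "\<dots> = ennreal ?G * ?J" by (intro nn_integral_cmult) auto
    finally show "(\<integral>\<^sup>+y. ennreal (gas_weight \<beta> w I x * (v y * (\<Prod>i\<in>I. exp (\<beta> * ln \<bar>x i - y\<bar>)))) \<partial>lborel) \<le> ennreal ?G * ?J" .
  qed
  also have "\<dots> = (\<integral>\<^sup>+x. ennreal (gas_weight \<beta> w I x * (\<Prod>i\<in>I. (1 + \<bar>x i\<bar>) powr \<beta>)) \<partial>PiM I (\<lambda>_. lborel)) * ?J"
  proof -
    have [measurable]: "(\<lambda>x. \<Prod>i\<in>I. (1 + \<bar>x i\<bar>) powr \<beta>) \<in> borel_measurable (PiM I (\<lambda>_. lborel :: real measure))"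
      using measurable_component_singleton[of _ I "\<lambda>_. lborel"]
      by (intro borel_measurable_prod powr_real_measurable borel_measurable_add borel_measurable_abs) auto
    show ?thesis using assms by (intro nn_integral_multc) measurable
  qed
  also have "\<dots> \<le> ennreal (2 * D powr a) * Z I * ?J"
    using assms by (intro mult_right_mono nn_integral_gas_weight_powr_le) auto
  finally show ?thesis .
qed

end

section \<open>Tail inequalities for the log-gas\<close>

lemma log_gas_weight_eq:
  "log_gas_weight \<alpha> V N = gas_weight (2 * \<alpha> / real N) (\<lambda>y. exp (- V y)) {1..N}"
proof
  fix x
  have "{i \<in> {1..N}. i < j} = {1..<j}" if "j \<in> {1..N}" for j
    using that by auto
  then show "log_gas_weight \<alpha> V N x = gas_weight (2 * \<alpha> / real N) (\<lambda>y. exp (- V y)) {1..N} x"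
    unfolding log_gas_weight_def gas_weight_def by (simp add: log_kernel_def)
qed

section \<open>Events determined by the largest particle\<close>

lemma x_max_le_iff: "1 \<le> N \<Longrightarrow> x_max N x \<le> t \<longleftrightarrow> (\<forall>i\<in>{1..N}. x i \<le> t)"
  unfolding x_max_def by (subst Max_le_iff) auto

lemma le_x_max_iff: "1 \<le> N \<Longrightarrow> t \<le> x_max N x \<longleftrightarrow> (\<exists>i\<in>{1..N}. t \<le> x i)"
  unfolding x_max_def by (subst Max_ge_iff) auto

lemma less_x_max_iff: "1 \<le> N \<Longrightarrow> t < x_max N x \<longleftrightarrow> (\<exists>i\<in>{1..N}. t < x i)"
  unfolding x_max_def by (subst Max_gr_iff) auto

lemma space_log_gas: "space (log_gas \<alpha> V N) = space (PiM {1..N} (\<lambda>_. lborel :: real measure))"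
  and sets_log_gas [measurable_cong]: "sets (log_gas \<alpha> V N) = sets (PiM {1..N} (\<lambda>_. lborel :: real measure))"
  by (simp_all add: log_gas_def config_lebesgue_def)

lemma x_max_measurable [measurable]: "x_max N \<in> borel_measurable (PiM {1..N} (\<lambda>_. lborel))"
  unfolding x_max_def
  using measurable_component_singleton[of _ "{1..N}" "\<lambda>_. lborel :: real measure"]
  by (intro borel_measurable_Max) auto

text \<open>The constants \<open>c\<close> and \<open>C\<close> are fixed before \<open>N\<close>.
  For every \<open>N\<close> with \<open>2 * \<alpha> \<le> N\<close> they supply
  \<open>gas_weight_bounds\<close> with \<open>a = 2 * \<alpha>\<close> and pair exponent
  \<open>2 * \<alpha> / N\<close>, which explains the exponent in
  \<open>weight_moment\<close>.\<close>

locale log_gas_model =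
  fixes V :: "real \<Rightarrow> real" and \<alpha> c C :: real
  assumes \<alpha>: "0 < \<alpha>"
    and V_measurable [measurable]: "V \<in> borel_measurable borel"
    and weight_ge: "\<And>y. 0 \<le> y \<Longrightarrow> y \<le> 1 \<Longrightarrow> c \<le> exp (- V y)"
    and weight_moment: "(\<integral>\<^sup>+y. ennreal (exp (- V y) * (1 + \<bar>y\<bar>) powr (2 * \<alpha> + 1)) \<partial>lborel) \<le> ennreal C"
    and c_pos: "0 < c" and C_pos: "0 < C"
begin

abbreviation weight_on :: "real set \<Rightarrow> real \<Rightarrow> real" where
  "weight_on S y \<equiv> exp (- V y) * indicator S y"

abbreviation Z_on :: "nat \<Rightarrow> real set \<Rightarrow> nat set \<Rightarrow> ennreal" where
  "Z_on N S \<equiv> gas_weight_bounds.Z (weight_on S) (2 * \<alpha> / real N)"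

text \<open>\<open>c1\<close> and \<open>K\<close> are the lower factor \<open>c0\<close> and the
  upper factor \<open>2 * D powr a\<close> for adding a particle, at \<open>a = 2 * \<alpha>\<close>
  and \<open>D = max 1 (C / c1)\<close>; both are independent of \<open>N\<close>.\<close>

definition c1 :: real where "c1 = c * exp (- (8 * (2 * \<alpha>)))"

definition K :: real where "K = 2 * max 1 (C / c1) powr (2 * \<alpha>)"

lemma c1_pos: "0 < c1" using c_pos by (simp add: c1_def)

lemma K_pos: "0 < K" using zero_less_one by (auto simp: K_def max_def)

text \<open>Confinement to \<open>S\<close> only lowers the moment, and
  \<open>{0..1} \<subseteq> S\<close> preserves the lower bound, so all such \<open>S\<close> share
  the constants \<open>c\<close> and \<open>C\<close>. The condition
  \<open>2 * \<alpha> \<le> N\<close> makes the pair exponent at most 1.\<close>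

lemma gas_weight_bounds_weight_on:
  assumes "1 \<le> N" "2 * \<alpha> \<le> real N" and [measurable]: "S \<in> sets borel" and S: "{0..1} \<subseteq> S"
  shows "gas_weight_bounds (weight_on S) (2 * \<alpha>) (2 * \<alpha> / real N) c C"
proof
  show "0 \<le> weight_on S y" for y by simp
  show "weight_on S \<in> borel_measurable borel" by measurable
  show "c \<le> weight_on S y" if "0 \<le> y" "y \<le> 1" for y
    using that S weight_ge[of y] by (auto simp: indicator_def)
  have "(\<integral>\<^sup>+y. ennreal (weight_on S y * (1 + \<bar>y\<bar>) powr (2 * \<alpha> + 1)) \<partial>lborel)
    \<le> (\<integral>\<^sup>+y. ennreal (exp (- V y) * (1 + \<bar>y\<bar>) powr (2 * \<alpha> + 1)) \<partial>lborel)"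
    by (intro nn_integral_mono) (auto simp: indicator_def)
  then show "(\<integral>\<^sup>+y. ennreal (weight_on S y * (1 + \<bar>y\<bar>) powr (2 * \<alpha> + 1)) \<partial>lborel) \<le> ennreal C"
    using weight_moment by simp
qed (use assms \<alpha> c_pos C_pos in auto)

section \<open>The gas with a fixed number of particles\<close>

context
  fixes N :: nat
  assumes N: "1 \<le> N" "2 * \<alpha> \<le> real N"
begin

abbreviation "G \<equiv> log_gas \<alpha> V N"

lemma card_le: "I \<subseteq> {1..N} \<Longrightarrow> 2 * \<alpha> / real N * real (card I) \<le> 2 * \<alpha>"
  using card_mono[of "{1..N}" I] \<alpha> N by (simp add: field_simps)

lemma Z_on_eq:
  assumes "S \<in> sets borel" "{0..1} \<subseteq> S" "finite I"
  shows "Z_on N S I = (\<integral>\<^sup>+x. ennreal (gas_weight (2 * \<alpha> / real N) (\<lambda>y. exp (- V y)) I x) *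
    indicator {x. \<forall>i\<in>I. x i \<in> S} x \<partial>PiM I (\<lambda>_. lborel))"
proof -
  interpret gas_weight_bounds "weight_on S" "2 * \<alpha>" "2 * \<alpha> / real N" c C
    by (intro gas_weight_bounds_weight_on N assms)
  show ?thesis
    unfolding Z_def gas_weight_indicator[OF assms(3)]
    by (intro nn_integral_cong) (simp add: ennreal_mult' ennreal_indicator indicator_def)
qed

interpretation full: gas_weight_bounds "weight_on UNIV" "2 * \<alpha>" "2 * \<alpha> / real N" c C
  by (intro gas_weight_bounds_weight_on N) auto

lemma partition_function_eq: "partition_function \<alpha> V N = Z_on N UNIV {1..N}"
  unfolding partition_function_def config_lebesgue_def log_gas_weight_eq
  by (subst Z_on_eq) auto

lemma partition_function_pos: "partition_function \<alpha> V N \<noteq> 0"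
proof -
  have "0 < ennreal (full.c0 ^ card {1..N})" using full.c0_pos by simp
  also have "\<dots> \<le> partition_function \<alpha> V N"
    unfolding partition_function_eq by (intro full.Z_ge_power card_le) auto
  finally show ?thesis by simp
qed

lemma partition_function_finite: "partition_function \<alpha> V N \<noteq> \<infinity>"
  unfolding partition_function_eq using full.Z_finite[of "{1..N}"] card_le[of "{1..N}"] by simp

lemma emeasure_log_gas:
  assumes [measurable]: "A \<in> sets (PiM {1..N} (\<lambda>_. lborel :: real measure))"
  shows "emeasure G A = (\<integral>\<^sup>+x. ennreal (gas_weight (2 * \<alpha> / real N) (\<lambda>y. exp (- V y)) {1..N} x) *
     indicator A x \<partial>PiM {1..N} (\<lambda>_. lborel)) / partition_function \<alpha> V N"
proof -
  have "emeasure G A = (\<integral>\<^sup>+x. ennreal (gas_weight (2 * \<alpha> / real N) (\<lambda>y. exp (- V y)) {1..N} x) /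
     partition_function \<alpha> V N * indicator A x \<partial>PiM {1..N} (\<lambda>_. lborel))"
    unfolding log_gas_def config_lebesgue_def log_gas_weight_eq
    by (intro emeasure_density) measurable
  also have "\<dots> = (\<integral>\<^sup>+x. ennreal (gas_weight (2 * \<alpha> / real N) (\<lambda>y. exp (- V y)) {1..N} x) *
     indicator A x / partition_function \<alpha> V N \<partial>PiM {1..N} (\<lambda>_. lborel))"
    by (intro nn_integral_cong) (simp add: divide_ennreal_def mult_ac)
  also have "\<dots> = (\<integral>\<^sup>+x. ennreal (gas_weight (2 * \<alpha> / real N) (\<lambda>y. exp (- V y)) {1..N} x) *
     indicator A x \<partial>PiM {1..N} (\<lambda>_. lborel)) / partition_function \<alpha> V N"
    by (intro nn_integral_divide) measurable
  finally show ?thesis .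
qed

lemma prob_space_log_gas: "prob_space G"
proof
  have "emeasure G (space G) = partition_function \<alpha> V N / partition_function \<alpha> V N"
    by (subst emeasure_log_gas)
       (auto simp: space_log_gas partition_function_def config_lebesgue_def log_gas_weight_eq
          intro!: arg_cong2[where f="(/)"] nn_integral_cong)
  also have "\<dots> = 1"
    using partition_function_pos partition_function_finite by (simp add: ennreal_divide_self top.not_eq_extremum)
  finally show "emeasure G (space G) = 1" .
qed

text \<open>Splitting off the coordinate \<open>k\<close> by Tonelli presents the event as a gas of
  \<open>N - 1\<close> particles in \<open>S\<close> with an additional particle in
  \<open>T\<close>. The tail estimates take \<open>S = UNIV\<close>, \<open>T = {t..}\<close> and
  \<open>S = {..t}\<close>, \<open>T = {t+1..t+2}\<close>.\<close>

lemma emeasure_log_gas_remove: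
  assumes k: "k \<in> {1..N}"
    and [measurable]: "A \<in> sets (PiM {1..N} (\<lambda>_. lborel :: real measure))"
    and S: "S \<in> sets borel" "{0..1} \<subseteq> S" and [measurable]: "T \<in> sets borel"
    and A: "\<And>x. x \<in> space (PiM {1..N} (\<lambda>_. lborel :: real measure)) \<Longrightarrow>
       x \<in> A \<longleftrightarrow> x k \<in> T \<and> (\<forall>i\<in>{1..N}-{k}. x i \<in> S)"
  shows "emeasure G A = (\<integral>\<^sup>+x. (\<integral>\<^sup>+y. ennreal (gas_weight (2 * \<alpha> / real N) (weight_on S) ({1..N}-{k}) x *
      (weight_on T y * (\<Prod>i\<in>{1..N}-{k}. exp (2 * \<alpha> / real N * ln \<bar>x i - y\<bar>)))) \<partial>lborel)
      \<partial>PiM ({1..N}-{k}) (\<lambda>_. lborel)) / partition_function \<alpha> V N"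
proof -
  define I where "I = {1..N} - {k}"
  have I: "finite I" "k \<notin> I" "insert k I = {1..N}" using k by (auto simp: I_def)
  let ?b = "2 * \<alpha> / real N" and ?e = "\<lambda>y. exp (- V y)"
  have "(\<integral>\<^sup>+x. ennreal (gas_weight ?b ?e (insert k I) x) * indicator A x \<partial>PiM (insert k I) (\<lambda>_. lborel))
      = (\<integral>\<^sup>+x. (\<integral>\<^sup>+y. ennreal (gas_weight ?b ?e (insert k I) (x(k := y))) * indicator A (x(k := y)) \<partial>lborel)
      \<partial>PiM I (\<lambda>_. lborel))"
    by (rule lborel_prod.product_nn_integral_insert[OF I(1,2)]) (unfold I(3), measurable)
  also have "\<dots> = (\<integral>\<^sup>+x. (\<integral>\<^sup>+y. ennreal (gas_weight ?b (weight_on S) I x *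
      (weight_on T y * (\<Prod>i\<in>I. exp (?b * ln \<bar>x i - y\<bar>)))) \<partial>lborel) \<partial>PiM I (\<lambda>_. lborel))"
  proof (intro nn_integral_cong)
    fix x :: "nat \<Rightarrow> real" and y :: real
    assume x: "x \<in> space (PiM I (\<lambda>_. lborel))"
    have "x(k := y) \<in> space (PiM {1..N} (\<lambda>_. lborel))"
      using x unfolding I(3)[symmetric] by (auto simp: space_PiM PiE_insert_eq extensional_def PiE_def)
    then have "x(k := y) \<in> A \<longleftrightarrow> y \<in> T \<and> (\<forall>i\<in>I. x i \<in> S)"
      by (subst A) (auto simp: I_def)
    then have ind: "indicator A (x(k := y)) = (indicator T y * indicator {x. \<forall>i\<in>I. x i \<in> S} x :: real)"
      by (simp add: indicator_def)
    have "ennreal (gas_weight ?b ?e (insert k I) (x(k := y))) * indicator A (x(k := y))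
       = ennreal (gas_weight ?b ?e (insert k I) (x(k := y)) * indicator A (x(k := y)))"
      by (simp add: ennreal_mult'' ennreal_indicator)
    also have "\<dots> = ennreal (gas_weight ?b (weight_on S) I x *
      (weight_on T y * (\<Prod>i\<in>I. exp (?b * ln \<bar>x i - y\<bar>))))"
      unfolding gas_weight_insert_upd[OF I(1,2)] gas_weight_indicator[OF I(1)] ind by (simp only: mult_ac)
    finally show "ennreal (gas_weight ?b ?e (insert k I) (x(k := y))) * indicator A (x(k := y)) = \<dots>" .
  qed
  finally show ?thesis
    unfolding I(3) by (simp only: emeasure_log_gas[OF assms(2)] I_def)
qed

text \<open>A union bound over the particle lying above \<open>t\<close> gives the factor
  \<open>N\<close>. Adding that particle to the other \<open>N - 1\<close> costs at most
  \<open>K * h\<close>, and \<open>Z_insert_ge\<close> bounds their partition function by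
  \<open>1 / c1\<close> times the full one.\<close>

lemma log_gas_upper_tail:
  assumes h: "(\<integral>\<^sup>+y. ennreal (weight_on {t..} y * (1 + \<bar>y\<bar>) powr (2 * \<alpha>)) \<partial>lborel) \<le> ennreal h" "0 \<le> h"
  shows "measure G {x \<in> space G. t \<le> x_max N x} \<le> real N * (K / c1) * h"
proof -
  interpret prob_space G by (rule prob_space_log_gas)
  define E where "E k = {x \<in> space G. t \<le> x k}" for k
  have E_sets: "E k \<in> sets (PiM {1..N} (\<lambda>_. lborel :: real measure))" if "k \<in> {1..N}" for k
  proof -
    have [measurable]: "(\<lambda>x. x k) \<in> borel_measurable (PiM {1..N} (\<lambda>_. lborel :: real measure))"
      using measurable_component_singleton[OF that, of "\<lambda>_. lborel :: real measure"] by simp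
    show ?thesis unfolding E_def space_log_gas by measurable
  qed
  have E: "emeasure G (E k) \<le> ennreal (K / c1 * h)" if k: "k \<in> {1..N}" for k
  proof -
    let ?I = "{1..N} - {k}" and ?Z = "partition_function \<alpha> V N"
    have I: "insert k ?I = {1..N}" using k by auto
    have "emeasure G (E k) = (\<integral>\<^sup>+x. (\<integral>\<^sup>+y. ennreal (gas_weight (2 * \<alpha> / real N) (weight_on UNIV) ?I x *
      (weight_on {t..} y * (\<Prod>i\<in>?I. exp (2 * \<alpha> / real N * ln \<bar>x i - y\<bar>)))) \<partial>lborel)
      \<partial>PiM ?I (\<lambda>_. lborel)) / ?Z"
      using k E_sets[OF k] by (intro emeasure_log_gas_remove) (auto simp: E_def space_log_gas)
    also have "\<dots> \<le> (ennreal (2 * max 1 (C / c1) powr (2 * \<alpha>)) * Z_on N UNIV ?I *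
       (\<integral>\<^sup>+y. ennreal (weight_on {t..} y * (1 + \<bar>y\<bar>) powr (2 * \<alpha>)) \<partial>lborel)) / ?Z"
      by (intro divide_right_mono_ennreal full.nn_integral_extra_particle_le card_le)
         (auto simp: c1_def)
    also have "\<dots> \<le> (ennreal K * (ennreal (1 / c1) * ?Z) * ennreal h) / ?Z"
    proof -
      have "ennreal (1 / c1) * (ennreal c1 * Z_on N UNIV ?I) \<le> ennreal (1 / c1) * Z_on N UNIV {1..N}"
        using full.Z_insert_ge[of ?I k] k card_le[of ?I] I
        by (intro mult_left_mono) (auto simp: c1_def)
      then have "Z_on N UNIV ?I \<le> ennreal (1 / c1) * ?Z"
        using c1_pos by (simp add: partition_function_eq mult.assoc[symmetric] flip: ennreal_mult)
      then show ?thesis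
        unfolding K_def using h by (intro divide_right_mono_ennreal mult_mono) auto
    qed
    also have "\<dots> = ennreal (K / c1 * h) * (?Z / ?Z)"
    proof -
      have "ennreal (K / c1 * h) = ennreal K * ennreal (1 / c1) * ennreal h"
        using K_pos c1_pos h by (simp flip: ennreal_mult)
      then show ?thesis by (simp add: divide_ennreal_def mult_ac)
    qed
    also have "\<dots> = ennreal (K / c1 * h)"
      using partition_function_pos partition_function_finite by (simp add: ennreal_divide_self top.not_eq_extremum)
    finally show ?thesis .
  qed
  have "emeasure G {x \<in> space G. t \<le> x_max N x} = emeasure G (\<Union>k\<in>{1..N}. E k)"
    using N by (intro arg_cong[where f="emeasure G"]) (auto simp: E_def le_x_max_iff)
  also have "\<dots> \<le> (\<Sum>k\<in>{1..N}. emeasure G (E k))"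
    using E_sets by (intro emeasure_subadditive_finite) (auto simp: sets_log_gas)
  also have "\<dots> \<le> (\<Sum>k\<in>{1..N}. ennreal (K / c1 * h))"
    by (intro sum_mono E)
  also have "\<dots> = ennreal (real N * (K / c1) * h)"
    using K_pos c1_pos h by (simp add: ennreal_of_nat_eq_real_of_nat mult.assoc flip: ennreal_mult)
  finally show ?thesis
    using K_pos c1_pos h by (simp add: emeasure_eq_measure)
qed

text \<open>Taking one particle out of a gas confined to \<open>{..t}\<close> costs at most the
  factor \<open>K * C\<close>; putting it back into \<open>{t+1..t+2}\<close> costs at most
  \<open>exp (- q)\<close>. The choice of the particle gives \<open>N\<close> disjoint events, hence
  the factor \<open>N\<close>.\<close>

lemma log_gas_push_one_particle:
  assumes t: "1 \<le> t" and q: "\<And>y. t + 1 \<le> y \<Longrightarrow> y \<le> t + 2 \<Longrightarrow> V y \<le> q"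
  shows "real N / (K * C) * exp (- q) * measure G {x \<in> space G. x_max N x \<le> t}
    \<le> measure G {x \<in> space G. t < x_max N x \<and> x_max N x \<le> t + 2}"
proof -
  interpret prob_space G by (rule prob_space_log_gas)
  let ?S = "{..t}" and ?T = "{t+1..t+2}" and ?b = "2 * \<alpha> / real N" and ?Z = "partition_function \<alpha> V N"
  \<comment> \<open>\<open>1 \<le> t\<close> ensures
    \<open>{0..1} \<subseteq> {..t}\<close>.\<close>
  interpret S: gas_weight_bounds "weight_on ?S" "2 * \<alpha>" "2 * \<alpha> / real N" c C
    using t by (intro gas_weight_bounds_weight_on N) auto
  define E where "E k = {x \<in> space G. x k \<in> ?T \<and> (\<forall>i\<in>{1..N}-{k}. x i \<in> ?S)}" for k
  let ?p = "measure G {x \<in> space G. x_max N x \<le> t}"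
  have E_sets: "E k \<in> sets (PiM {1..N} (\<lambda>_. lborel :: real measure))" if "k \<in> {1..N}" for k
  proof -
    have [measurable]: "(\<lambda>x. x i) \<in> borel_measurable (PiM {1..N} (\<lambda>_. lborel :: real measure))" if "i \<in> {1..N}" for i
      using measurable_component_singleton[OF that, of "\<lambda>_. lborel :: real measure"] by simp
    have "E k = {x \<in> space (PiM {1..N} (\<lambda>_. lborel :: real measure)). x k \<in> ?T} \<inter>
        {x \<in> space (PiM {1..N} (\<lambda>_. lborel :: real measure)). \<forall>i\<in>{1..N}-{k}. x i \<in> ?S}"
      by (auto simp: E_def space_log_gas)
    also have "\<dots> \<in> sets (PiM {1..N} (\<lambda>_. lborel :: real measure))"
      using that by (intro sets.Int sets.sets_Collect_finite_All) auto
    finally show ?thesis .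
  qed
  have p_eq: "ennreal ?p = Z_on N ?S {1..N} / ?Z"
  proof -
    have m: "{x \<in> space G. x_max N x \<le> t} \<in> sets (PiM {1..N} (\<lambda>_. lborel :: real measure))"
      unfolding space_log_gas by measurable
    have "ennreal ?p = emeasure G {x \<in> space G. x_max N x \<le> t}" by (simp add: emeasure_eq_measure)
    also have "\<dots> = Z_on N ?S {1..N} / ?Z"
      using t N by (subst emeasure_log_gas[OF m], subst Z_on_eq)
         (auto intro!: arg_cong2[where f="(/)"] nn_integral_cong simp: indicator_def space_log_gas x_max_le_iff)
    finally show ?thesis .
  qed
  have E: "ennreal (exp (- q) / (K * C) * ?p) \<le> emeasure G (E k)" if k: "k \<in> {1..N}" for k
  proof -
    let ?I = "{1..N} - {k}"
    have I: "insert k ?I = {1..N}" using k by auto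
    have "Z_on N ?S (insert k ?I) = (\<integral>\<^sup>+x. (\<integral>\<^sup>+y. ennreal (gas_weight ?b (weight_on ?S) (insert k ?I) (x(k := y))) \<partial>lborel)
      \<partial>PiM ?I (\<lambda>_. lborel))"
      unfolding S.Z_def
      by (intro lborel_prod.product_nn_integral_insert measurable_compose[OF gas_weight_measurable]) auto
    also have "\<dots> = (\<integral>\<^sup>+x. (\<integral>\<^sup>+y. ennreal (gas_weight ?b (weight_on ?S) ?I x *
      (weight_on ?S y * (\<Prod>i\<in>?I. exp (?b * ln \<bar>x i - y\<bar>)))) \<partial>lborel) \<partial>PiM ?I (\<lambda>_. lborel))"
      by (simp only: gas_weight_insert_upd[of ?I k] finite_Diff finite_atLeastAtMost Diff_iff singletonI simp_thms)
    also have "\<dots> \<le> ennreal (2 * max 1 (C / c1) powr (2 * \<alpha>)) * Z_on N ?S ?I *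
       (\<integral>\<^sup>+y. ennreal (weight_on ?S y * (1 + \<bar>y\<bar>) powr (2 * \<alpha>)) \<partial>lborel)"
      by (intro S.nn_integral_extra_particle_le card_le) (auto simp: c1_def)
    also have "\<dots> \<le> ennreal K * Z_on N ?S ?I * ennreal C"
    proof -
      have "(\<integral>\<^sup>+y. ennreal (weight_on ?S y * (1 + \<bar>y\<bar>) powr (2 * \<alpha>)) \<partial>lborel)
         \<le> (\<integral>\<^sup>+y. ennreal (exp (- V y) * (1 + \<bar>y\<bar>) powr (2 * \<alpha> + 1)) \<partial>lborel)"
        by (intro nn_integral_mono ennreal_leI mult_mono powr_mono) (auto simp: indicator_def)
      also note weight_moment
      finally show ?thesis unfolding K_def by (intro mult_left_mono) auto
    qed
    finally have *: "Z_on N ?S {1..N} \<le> ennreal (K * C) * Z_on N ?S ?I"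
      unfolding I using K_pos C_pos by (simp add: ennreal_mult mult_ac)
    have "ennreal (exp (- q) / (K * C)) * Z_on N ?S {1..N} \<le>
       ennreal (exp (- q) / (K * C)) * (ennreal (K * C) * Z_on N ?S ?I)"
      by (intro mult_left_mono *) auto
    also have "\<dots> = ennreal (exp (- q)) * Z_on N ?S ?I"
      using K_pos C_pos by (simp add: mult.assoc[symmetric] flip: ennreal_mult)
    also have "\<dots> = (\<integral>\<^sup>+x. ennreal (gas_weight ?b (weight_on ?S) ?I x) * ennreal (exp (- q)) \<partial>PiM ?I (\<lambda>_. lborel))"
      unfolding S.Z_def by (subst mult.commute) (simp add: nn_integral_multc)
    \<comment> \<open>The interval \<open>?T\<close> has length 1 and starts at \<open>t + 1\<close>
      rather than \<open>t\<close>, so it keeps distance at least 1 from the other particles and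
      every pair factor is at least 1.\<close>
    also have "\<dots> \<le> (\<integral>\<^sup>+x. (\<integral>\<^sup>+y. ennreal (gas_weight ?b (weight_on ?S) ?I x *
      (weight_on ?T y * (\<Prod>i\<in>?I. exp (?b * ln \<bar>x i - y\<bar>)))) \<partial>lborel) \<partial>PiM ?I (\<lambda>_. lborel))"
    proof (intro nn_integral_mono)
      fix x :: "nat \<Rightarrow> real"
      let ?g = "gas_weight ?b (weight_on ?S) ?I x"
      have g: "0 \<le> ?g" by (intro gas_weight_nonneg) simp
      have "ennreal ?g * ennreal (exp (- q)) = (\<integral>\<^sup>+y. ennreal (?g * exp (- q)) * indicator ?T y \<partial>lborel)"
        using g by (simp add: nn_integral_cmult_indicator ennreal_mult)
      also have "\<dots> \<le> (\<integral>\<^sup>+y. ennreal (?g * (weight_on ?T y * (\<Prod>i\<in>?I. exp (?b * ln \<bar>x i - y\<bar>)))) \<partial>lborel)"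
      proof (intro nn_integral_mono)
        fix y
        show "ennreal (?g * exp (- q)) * indicator ?T y \<le> ennreal (?g * (weight_on ?T y * (\<Prod>i\<in>?I. exp (?b * ln \<bar>x i - y\<bar>))))"
        proof (cases "y \<in> ?T \<and> (\<forall>i\<in>?I. x i \<le> t)")
          case True
          have "1 \<le> (\<Prod>i\<in>?I. exp (?b * ln \<bar>x i - y\<bar>))"
          proof (intro prod_ge_1)
            fix i assume "i \<in> ?I"
            then have "1 \<le> \<bar>x i - y\<bar>" using True by force
            then show "1 \<le> exp (?b * ln \<bar>x i - y\<bar>)" using \<alpha> by simp
          qed
          then have "exp (- q) * 1 \<le> exp (- V y) * (\<Prod>i\<in>?I. exp (?b * ln \<bar>x i - y\<bar>))"
            using q[of y] True by (intro mult_mono) auto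
          then show ?thesis using True g by (auto intro!: ennreal_leI mult_left_mono)
        next
          case False
          then have "y \<notin> ?T \<or> \<not> (\<forall>i\<in>?I. x i \<le> t)" by blast
          then show ?thesis
          proof
            assume "y \<notin> ?T" then show ?thesis by simp
          next
            assume "\<not> (\<forall>i\<in>?I. x i \<le> t)"
            then have "?g = 0" by (subst gas_weight_indicator) (auto simp: indicator_def)
            then show ?thesis by simp
          qed
        qed
      qed
      finally show "ennreal ?g * ennreal (exp (- q)) \<le> \<dots>" .
    qed
    finally have "ennreal (exp (- q) / (K * C)) * Z_on N ?S {1..N} / ?Z \<le> \<dots> / ?Z"
      by (rule divide_right_mono_ennreal)
    also have "\<dots> = emeasure G (E k)"
      using k t E_sets[OF k] by (intro emeasure_log_gas_remove[symmetric]) (auto simp: E_def space_log_gas)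
    finally show ?thesis
      using K_pos C_pos by (simp only: ennreal_mult[OF _ measure_nonneg] p_eq ennreal_times_divide
          divide_nonneg_pos exp_ge_zero mult_pos_pos)
  qed
  have "disjoint_family_on E {1..N}"
    unfolding disjoint_family_on_def
  proof (intro ballI impI, rule ccontr)
    fix i j assume ij: "i \<in> {1..N}" "j \<in> {1..N}" "i \<noteq> j" "E i \<inter> E j \<noteq> {}"
    then obtain x where x: "x \<in> E i" "x \<in> E j" by blast
    then have "t + 1 \<le> x i" "x i \<le> t" using ij by (auto simp: E_def)
    then show False by simp
  qed
  then have "(\<Sum>k\<in>{1..N}. emeasure G (E k)) = emeasure G (\<Union>k\<in>{1..N}. E k)"
    using E_sets by (intro sum_emeasure) (auto simp: sets_log_gas)
  also have "\<dots> \<le> emeasure G {x \<in> space G. t < x_max N x \<and> x_max N x \<le> t + 2}"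
  proof (intro emeasure_mono)
    show "{x \<in> space G. t < x_max N x \<and> x_max N x \<le> t + 2} \<in> sets G"
      unfolding space_log_gas sets_log_gas by measurable
    show "(\<Union>k\<in>{1..N}. E k) \<subseteq> {x \<in> space G. t < x_max N x \<and> x_max N x \<le> t + 2}"
    proof
      fix x assume "x \<in> (\<Union>k\<in>{1..N}. E k)"
      then obtain k where k: "k \<in> {1..N}" "x \<in> E k" by blast
      then have "t < x k" "x k \<le> t + 2" "\<forall>i\<in>{1..N}-{k}. x i \<le> t" by (auto simp: E_def)
      then have "\<forall>i\<in>{1..N}. x i \<le> t + 2" by (metis Diff_iff add_increasing2 singletonD zero_le_numeral)
      then show "x \<in> {x \<in> space G. t < x_max N x \<and> x_max N x \<le> t + 2}"
        using N k \<open>t < x k\<close> unfolding E_def mem_Collect_eq x_max_le_iff[OF N(1)] less_x_max_iff[OF N(1)] by blast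
    qed
  qed
  finally have "(\<Sum>k\<in>{1..N}. ennreal (exp (- q) / (K * C) * ?p)) \<le>
      emeasure G {x \<in> space G. t < x_max N x \<and> x_max N x \<le> t + 2}"
    using sum_mono[of "{1..N}", OF E] by (rule order_trans[rotated])
  moreover have "(\<Sum>k\<in>{1..N}. ennreal (exp (- q) / (K * C) * ?p)) = ennreal (real N / (K * C) * exp (- q) * ?p)"
    using K_pos C_pos by (simp add: ennreal_of_nat_eq_real_of_nat mult_ac flip: ennreal_mult)
  ultimately show ?thesis
    by (simp add: emeasure_eq_measure)
qed

end

end

section \<open>Asymptotics at the logarithmic scale\<close>

text \<open>The little-o condition on the perturbation is applied with the constant
  \<open>\<epsilon> * \<theta>\<close>, a fraction of the leading coefficient.\<close>

lemma admissible_potential_growth: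
  assumes V: "admissible_potential d \<theta> V" and \<epsilon>: "0 < \<epsilon>"
  shows "\<exists>M. \<forall>y. M \<le> \<bar>y\<bar> \<longrightarrow>
    (1 - \<epsilon>) * \<theta> * \<bar>y\<bar> powr d \<le> V y \<and> V y \<le> (1 + \<epsilon>) * \<theta> * \<bar>y\<bar> powr d"
proof -
  from V obtain \<phi> where \<theta>: "0 < \<theta>" and eq: "\<And>y. V y = \<theta> * \<bar>y\<bar> powr d + \<phi> y"
    and "\<phi> \<in> o[at_infinity](\<lambda>x. \<bar>x\<bar> powr d)"
    unfolding admissible_potential_def potential_perturbation_def by blast
  then have "eventually (\<lambda>y. norm (\<phi> y) \<le> (\<epsilon> * \<theta>) * norm (\<bar>y\<bar> powr d)) at_infinity"
    using \<epsilon> by (intro landau_o.smallD) auto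
  then obtain M where M: "\<And>y. M \<le> \<bar>y\<bar> \<Longrightarrow> \<bar>\<phi> y\<bar> \<le> \<epsilon> * \<theta> * \<bar>y\<bar> powr d"
    unfolding eventually_at_infinity by auto
  have "(1 - \<epsilon>) * \<theta> * \<bar>y\<bar> powr d \<le> V y \<and> V y \<le> (1 + \<epsilon>) * \<theta> * \<bar>y\<bar> powr d" if "M \<le> \<bar>y\<bar>" for y
    using M[OF that] unfolding eq abs_le_iff by (simp add: algebra_simps)
  then show ?thesis by blast
qed

section \<open>Moments of the Boltzmann weight\<close>

lemma nn_integral_inverse_1_plus_square_finite:
  "(\<integral>\<^sup>+y. ennreal (inverse (1 + (y::real)\<^sup>2)) \<partial>lborel) < \<infinity>"
proof -
  have "integrable lborel (\<lambda>y::real. inverse (1 + y\<^sup>2))"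
    using integrable_inverse_1_plus_square
    by (simp add: set_integrable_def einterval_eq_UNIV)
  then show ?thesis
    by (auto simp: integrable_iff_bounded)
qed

text \<open>As \<open>1 \<le> d\<close>, the potential grows at least linearly, so the exponential
  beats every power and the integrand is dominated by a multiple of
  \<open>inverse (1 + y^2)\<close>. The factor \<kappa> allows a small share of the potential to be
  set aside for integrability.\<close>

lemma admissible_potential_moment:
  assumes V: "admissible_potential d \<theta> V" and \<kappa>: "0 < \<kappa>"
  shows "\<exists>B>0. (\<integral>\<^sup>+y. ennreal (exp (- (\<kappa> * V y)) * (1 + \<bar>y\<bar>) powr p) \<partial>lborel) \<le> ennreal B"
proof -
  have d: "1 \<le> d" and \<theta>: "0 < \<theta>" and cont: "continuous_on UNIV V"
    using V by (auto simp: admissible_potential_def)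
  define f where "f y = exp (- (\<kappa> * V y)) * (1 + \<bar>y\<bar>) powr p" for y
  obtain M where M: "\<And>y. M \<le> \<bar>y\<bar> \<Longrightarrow> (1 - 1/2) * \<theta> * \<bar>y\<bar> powr d \<le> V y"
    using admissible_potential_growth[OF V, of "1/2"] by auto
  define e where "e = \<kappa> * \<theta> / 2"
  have e: "0 < e" using \<kappa> \<theta> by (simp add: e_def)
  have "((\<lambda>u. exp (- (e * u)) * (1 + u) powr p * (1 + u\<^sup>2)) \<longlongrightarrow> 0) at_top"
    using e by real_asymp
  then have "eventually (\<lambda>u. exp (- (e * u)) * (1 + u) powr p * (1 + u\<^sup>2) < 1) at_top"
    by (rule order_tendstoD) simp
  then obtain M' where M': "\<And>u. M' \<le> u \<Longrightarrow> exp (- (e * u)) * (1 + u) powr p * (1 + u\<^sup>2) < 1"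
    unfolding eventually_at_top_linorder by auto
  define L where "L = max 1 (max M M')"
  have out: "f y * (1 + y\<^sup>2) \<le> 1" if "L \<le> \<bar>y\<bar>" for y
  proof -
    have y: "1 \<le> \<bar>y\<bar>" "M \<le> \<bar>y\<bar>" "M' \<le> \<bar>y\<bar>" using that by (auto simp: L_def)
    have "\<bar>y\<bar> powr 1 \<le> \<bar>y\<bar> powr d" using y d by (intro powr_mono) auto
    then have "(1 - 1/2) * \<theta> * \<bar>y\<bar> \<le> (1 - 1/2) * \<theta> * \<bar>y\<bar> powr d"
      using \<theta> y by (intro mult_left_mono) auto
    then have "\<theta> / 2 * \<bar>y\<bar> \<le> V y" using M[OF y(2)] by simp
    then have "\<kappa> * (\<theta> / 2 * \<bar>y\<bar>) \<le> \<kappa> * V y" using \<kappa> by (intro mult_left_mono) auto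
    then have "exp (- (\<kappa> * V y)) \<le> exp (- (e * \<bar>y\<bar>))" by (simp add: e_def)
    then have "f y * (1 + y\<^sup>2) \<le> exp (- (e * \<bar>y\<bar>)) * (1 + \<bar>y\<bar>) powr p * (1 + \<bar>y\<bar>\<^sup>2)"
      unfolding f_def by (intro mult_mono) auto
    also have "\<dots> < 1" by (rule M'[OF y(3)])
    finally show ?thesis by simp
  qed
  have "continuous_on {-L..L} (\<lambda>y. f y * (1 + y\<^sup>2))"
    unfolding f_def by (intro continuous_intros continuous_on_subset[OF cont]) auto
  then have "bounded ((\<lambda>y. f y * (1 + y\<^sup>2)) ` {-L..L})"
    by (intro compact_imp_bounded compact_continuous_image) auto
  then obtain b where b: "\<And>y. y \<in> {-L..L} \<Longrightarrow> \<bar>f y * (1 + y\<^sup>2)\<bar> \<le> b"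
    unfolding bounded_iff by fastforce
  define b' where "b' = max 1 b"
  have le: "f y \<le> b' * inverse (1 + y\<^sup>2)" for y
  proof -
    have "f y * (1 + y\<^sup>2) \<le> b'"
    proof (cases "L \<le> \<bar>y\<bar>")
      case True then show ?thesis using out[of y] by (simp add: b'_def)
    next
      case False
      then have "y \<in> {-L..L}" by auto
      then show ?thesis using order_trans[OF abs_ge_self b] by (auto simp: b'_def le_max_iff_disj)
    qed
    moreover have "0 < 1 + y\<^sup>2" by (simp add: add_pos_nonneg)
    ultimately show ?thesis by (simp add: field_simps)
  qed
  have "(\<integral>\<^sup>+y. ennreal (f y) \<partial>lborel) \<le> (\<integral>\<^sup>+y. ennreal b' * ennreal (inverse (1 + y\<^sup>2)) \<partial>lborel)"
    using le by (intro nn_integral_mono) (auto simp: b'_def ennreal_leI simp flip: ennreal_mult)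
  also have "\<dots> = ennreal b' * (\<integral>\<^sup>+y. ennreal (inverse (1 + y\<^sup>2)) \<partial>lborel)"
    by (intro nn_integral_cmult) auto
  also have "\<dots> < \<infinity>"
    using nn_integral_inverse_1_plus_square_finite by (simp add: ennreal_mult_less_top)
  finally obtain r where r: "(\<integral>\<^sup>+y. ennreal (f y) \<partial>lborel) = ennreal r" "0 \<le> r"
    by (cases "\<integral>\<^sup>+y. ennreal (f y) \<partial>lborel") auto
  show ?thesis
    using r by (intro exI[of _ "r + 1"]) (auto simp: f_def intro!: ennreal_leI)
qed

section \<open>Power bounds in N at the scale \<open>R N\<close>\<close>

locale log_gas_asymptotics = log_gas_model +
  fixes d \<theta> :: real
  assumes V: "admissible_potential d \<theta> V"
begin

lemma d: "1 \<le> d" and \<theta>: "0 < \<theta>"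
  using V by (auto simp: admissible_potential_def)

definition R :: "nat \<Rightarrow> real" where "R N = (ln (real N) / \<theta>) powr (1 / d)"

lemma R_at_top: "filterlim R at_top sequentially"
  unfolding R_def using d \<theta> by real_asymp

lemma R_nonneg: "0 \<le> R N"
  by (simp add: R_def)

text \<open>This is why \<open>R\<close> is the right scale: near \<open>b * R N\<close> the
  potential is about \<open>b powr d * ln N\<close>, so \<open>exp (- V)\<close> is about
  \<open>N powr (- (b powr d))\<close>.\<close>

lemma R_powr: "1 \<le> N \<Longrightarrow> \<theta> * R N powr d = ln (real N)"
  unfolding R_def using d \<theta> by (simp add: powr_powr)

lemma R_ge: "0 < \<epsilon> \<Longrightarrow> eventually (\<lambda>N. b \<le> \<epsilon> * R N) sequentially"
  using R_at_top filterlim_at_top_mult_tendsto_pos[OF tendsto_const, of \<epsilon> R sequentially]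
  by (simp add: filterlim_at_top mult.commute)

lemma powr_one_minus: "0 < n \<Longrightarrow> n powr (1 - q) = n * exp (- (q * ln n))" for n q :: real
  by (simp add: powr_diff powr_def[of n q] exp_minus divide_inverse)

text \<open>Constants such as \<open>K\<close>, \<open>C\<close> and \<open>c1\<close> are absorbed
  by an arbitrarily small loss in the exponent.\<close>

lemma const_times_powr_le:
  assumes "p < q"
  shows "eventually (\<lambda>N. b * real N powr p \<le> real N powr q) sequentially"
proof -
  have "((\<lambda>N. b * real N powr (p - q)) \<longlongrightarrow> 0) sequentially"
    using assms by real_asymp
  then have "eventually (\<lambda>N. b * real N powr (p - q) < 1) sequentially"
    by (rule order_tendstoD) simp
  then show ?thesis
    using eventually_gt_at_top[of 0]
  proof eventually_elim
    case (elim N)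
    then have "b * real N powr (p - q) * real N powr q \<le> 1 * real N powr q"
      by (intro mult_right_mono) auto
    then show ?case by (simp add: mult.assoc flip: powr_add)
  qed
qed

text \<open>The margin \<open>\<epsilon> * R N\<close> eventually exceeds any fixed length, so the
  bound holds on the intervals just above \<open>b * R N\<close> into which particles are
  pushed.\<close>

lemma potential_le_near_scale:
  assumes b: "0 < b" and q: "b powr d < q"
  shows "\<exists>\<epsilon>>0. \<exists>M. \<forall>N y. 1 \<le> N \<longrightarrow> M \<le> y \<longrightarrow> y \<le> (b + \<epsilon>) * R N \<longrightarrow> V y \<le> q * ln (real N)"
proof -
  \<comment> \<open>A single \<epsilon> serves both as the relative error of the potential and as
    the overshoot beyond \<open>b\<close>; continuity at 0 keeps the combined exponent below
    \<open>q\<close>.\<close>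
  have "((\<lambda>\<epsilon>. (1 + \<epsilon>) * (b + \<epsilon>) powr d) \<longlongrightarrow> (1 + 0) * (b + 0) powr d) (at_right 0)"
    using b by (intro tendsto_intros) auto
  then have "eventually (\<lambda>\<epsilon>. (1 + \<epsilon>) * (b + \<epsilon>) powr d < q) (at_right 0)"
    using q by (intro order_tendstoD(2)) auto
  then have "eventually (\<lambda>\<epsilon>. (1 + \<epsilon>) * (b + \<epsilon>) powr d < q \<and> 0 < \<epsilon>) (at_right 0)"
    by (intro eventually_conj eventually_at_right_less)
  then obtain \<epsilon> where \<epsilon>: "(1 + \<epsilon>) * (b + \<epsilon>) powr d < q" "0 < \<epsilon>"
    using eventually_happens'[OF trivial_limit_at_right_real] by blast
  obtain M where M: "\<And>y. M \<le> \<bar>y\<bar> \<Longrightarrow> V y \<le> (1 + \<epsilon>) * \<theta> * \<bar>y\<bar> powr d"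
    using admissible_potential_growth[OF V \<epsilon>(2)] by auto
  have "V y \<le> q * ln (real N)" if "1 \<le> N" "max 0 M \<le> y" "y \<le> (b + \<epsilon>) * R N" for N y
  proof -
    have "V y \<le> (1 + \<epsilon>) * \<theta> * y powr d" using M[of y] that by simp
    also have "\<dots> \<le> (1 + \<epsilon>) * \<theta> * ((b + \<epsilon>) * R N) powr d"
      using that \<epsilon> \<theta> d by (intro mult_left_mono powr_mono2) auto
    also have "\<dots> = (1 + \<epsilon>) * (b + \<epsilon>) powr d * (\<theta> * R N powr d)"
      using b \<epsilon> by (simp add: powr_mult R_def)
    also have "\<dots> \<le> q * ln (real N)"
      using that \<epsilon> by (subst R_powr) (auto intro!: mult_right_mono)
    finally show ?thesis .
  qed
  then show ?thesis using \<epsilon>(2) by blast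
qed

text \<open>The weight is split as
  \<open>exp (- (1 - \<epsilon>) * V) * exp (- \<epsilon> * V)\<close>. Above \<open>x * R N\<close>
  the first factor is at most \<open>N powr (- q)\<close> with \<open>q\<close> close to
  \<open>x powr d\<close>, and the second is integrable against the polynomial moment. The factor
  \<open>N\<close> of the union bound accounts for the \<open>- 1\<close> in the rate.\<close>

lemma upper_tail_decay:
  assumes x: "0 < x" and s: "s < x powr d - 1"
  shows "eventually (\<lambda>N. measure (log_gas \<alpha> V N) {z \<in> space (log_gas \<alpha> V N). x * R N \<le> x_max N z}
    \<le> real N powr (- s)) sequentially"
proof -
  have "((\<lambda>\<epsilon>. (1 - \<epsilon>)\<^sup>2 * x powr d - 1) \<longlongrightarrow> (1 - 0)\<^sup>2 * x powr d - 1) (at_right 0)"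
    by (intro tendsto_intros)
  then have "eventually (\<lambda>\<epsilon>. s < (1 - \<epsilon>)\<^sup>2 * x powr d - 1) (at_right 0)"
    using s by (intro order_tendstoD(1)) auto
  then have "eventually (\<lambda>\<epsilon>. s < (1 - \<epsilon>)\<^sup>2 * x powr d - 1 \<and> \<epsilon> \<in> {0<..<1}) (at_right 0)"
    by (intro eventually_conj eventually_at_right_real) simp_all
  then obtain \<epsilon> where \<epsilon>: "s < (1 - \<epsilon>)\<^sup>2 * x powr d - 1" "0 < \<epsilon>" "\<epsilon> < 1"
    using eventually_happens'[OF trivial_limit_at_right_real] by force
  obtain M where M: "\<And>y. M \<le> \<bar>y\<bar> \<Longrightarrow> (1 - \<epsilon>) * \<theta> * \<bar>y\<bar> powr d \<le> V y"
    using admissible_potential_growth[OF V \<epsilon>(2)] by auto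
  obtain B where B: "0 < B"
    "(\<integral>\<^sup>+y. ennreal (exp (- (\<epsilon> * V y)) * (1 + \<bar>y\<bar>) powr (2 * \<alpha>)) \<partial>lborel) \<le> ennreal B"
    using admissible_potential_moment[OF V \<epsilon>(2)] by blast
  \<comment> \<open>One factor \<open>1 - \<epsilon>\<close> comes from the growth bound for
    \<open>V\<close>, the other from the share of \<open>V\<close> kept for integrability.\<close>
  define q where "q = (1 - \<epsilon>)\<^sup>2 * x powr d"
  have "1 - q < - s" using \<epsilon> by (simp add: q_def)
  from const_times_powr_le[OF this, of "K / c1 * B"] R_ge[OF x, of "max 0 M"]
    eventually_ge_at_top[of 1] eventually_ge_at_top[of "nat \<lceil>2 * \<alpha>\<rceil>"]
  show ?thesis
  proof eventually_elim
    case (elim N)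
    define t where "t = x * R N"
    have t: "0 \<le> t" "M \<le> t" using elim by (auto simp: t_def)
    have N: "1 \<le> N" "2 * \<alpha> \<le> real N" using elim by linarith+
    have decay: "exp (- V y) \<le> real N powr (- q) * exp (- (\<epsilon> * V y))" if "t \<le> y" for y
    proof -
      have "q * ln (real N) = (1 - \<epsilon>) * ((1 - \<epsilon>) * \<theta> * t powr d)"
      proof -
        have "\<theta> * t powr d = x powr d * (\<theta> * R N powr d)"
          using x by (simp add: t_def powr_mult R_nonneg)
        then show ?thesis by (simp add: R_powr[OF N(1)] q_def power2_eq_square)
      qed
      also have "\<dots> \<le> (1 - \<epsilon>) * ((1 - \<epsilon>) * \<theta> * y powr d)"
        using \<epsilon> \<theta> that t d by (intro mult_left_mono powr_mono2) auto
      also have "\<dots> \<le> (1 - \<epsilon>) * V y"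
        using \<epsilon> that t M[of y] by (intro mult_left_mono) auto
      finally have "exp (- V y) \<le> exp (- (q * ln (real N)) + - (\<epsilon> * V y))"
        by (simp add: algebra_simps)
      also have "\<dots> = real N powr (- q) * exp (- (\<epsilon> * V y))"
        using N unfolding exp_add by (simp add: powr_def)
      finally show ?thesis .
    qed
    have "(\<integral>\<^sup>+y. ennreal (weight_on {t..} y * (1 + \<bar>y\<bar>) powr (2 * \<alpha>)) \<partial>lborel)
      \<le> (\<integral>\<^sup>+y. ennreal (real N powr (- q)) * ennreal (exp (- (\<epsilon> * V y)) * (1 + \<bar>y\<bar>) powr (2 * \<alpha>)) \<partial>lborel)"
    proof (intro nn_integral_mono)
      fix y
      have "weight_on {t..} y \<le> real N powr (- q) * exp (- (\<epsilon> * V y))"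
        using decay[of y] by (auto simp: indicator_def)
      then have "weight_on {t..} y * (1 + \<bar>y\<bar>) powr (2 * \<alpha>)
        \<le> real N powr (- q) * exp (- (\<epsilon> * V y)) * (1 + \<bar>y\<bar>) powr (2 * \<alpha>)"
        by (intro mult_right_mono) auto
      then show "ennreal (weight_on {t..} y * (1 + \<bar>y\<bar>) powr (2 * \<alpha>)) \<le>
        ennreal (real N powr (- q)) * ennreal (exp (- (\<epsilon> * V y)) * (1 + \<bar>y\<bar>) powr (2 * \<alpha>))"
        by (simp add: mult.assoc ennreal_leI flip: ennreal_mult)
    qed
    also have "\<dots> = ennreal (real N powr (- q)) * (\<integral>\<^sup>+y. ennreal (exp (- (\<epsilon> * V y)) * (1 + \<bar>y\<bar>) powr (2 * \<alpha>)) \<partial>lborel)"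
      by (intro nn_integral_cmult) measurable
    also have "\<dots> \<le> ennreal (real N powr (- q)) * ennreal B"
      by (intro mult_left_mono B) auto
    also have "\<dots> = ennreal (real N powr (- q) * B)" using B by (simp add: ennreal_mult)
    finally have "measure (log_gas \<alpha> V N) {z \<in> space (log_gas \<alpha> V N). t \<le> x_max N z}
      \<le> real N * (K / c1) * (real N powr (- q) * B)"
      using B by (intro log_gas_upper_tail N) auto
    also have "\<dots> = K / c1 * B * real N powr (1 - q)"
      using N by (simp add: powr_diff powr_minus field_simps)
    also have "\<dots> \<le> real N powr (- s)" using elim by simp
    finally show ?case by (simp add: t_def)
  qed
qed

text \<open>Moving one particle into \<open>{t+1..t+2}\<close> gains a power of \<open>N\<close>, and this can be repeated any
  fixed number of times.\<close>

lemma lower_tail_decay: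
  assumes b: "0 < b" "b < 1"
  shows "eventually (\<lambda>N. measure (log_gas \<alpha> V N) {z \<in> space (log_gas \<alpha> V N). x_max N z \<le> b * R N}
    \<le> real N powr (- s)) sequentially"
proof -
  have "b powr d < 1" using b d powr_less_mono2[of d b 1] by simp
  then obtain q where q: "b powr d < q" "q < 1" using dense by blast
  \<comment> \<open>With \<open>n\<close> pushes, each gaining \<open>N powr (1 - q)\<close> up to a
    constant, the total exponent \<open>(1 - q) * n\<close> exceeds \<open>s\<close>.\<close>
  obtain n :: nat where n: "s / (1 - q) < real n" using reals_Archimedean2 by blast
  obtain \<epsilon> M where \<epsilon>: "0 < \<epsilon>"
    and M: "\<And>N y. 1 \<le> N \<Longrightarrow> M \<le> y \<Longrightarrow> y \<le> (b + \<epsilon>) * R N \<Longrightarrow> V y \<le> q * ln (real N)"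
    using potential_le_near_scale[OF b(1) q(1)] by blast
  have "(q - 1) * real n < - s" using n q by (simp add: field_simps)
  from const_times_powr_le[OF this, of "(K * C) ^ n"] R_ge[OF b(1), of "max 1 M"]
    R_ge[OF \<epsilon>, of "2 * real n"]
    eventually_ge_at_top[of 1] eventually_ge_at_top[of "nat \<lceil>2 * \<alpha>\<rceil>"]
  show ?thesis
  proof eventually_elim
    case (elim N)
    have N: "1 \<le> N" "2 * \<alpha> \<le> real N" using elim by linarith+
    interpret prob_space "log_gas \<alpha> V N" using N by (rule prob_space_log_gas)
    define p where "p t = prob {z \<in> space (log_gas \<alpha> V N). x_max N z \<le> t}" for t
    define g where "g = real N powr (1 - q) / (K * C)"
    have g: "0 \<le> g" using K_pos C_pos by (simp add: g_def)
    have ev: "{z \<in> space (log_gas \<alpha> V N). x_max N z \<le> t} \<in> events" for t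
      unfolding space_log_gas sets_log_gas by measurable
    have step: "g * p t \<le> p (t + 2)" if t: "b * R N \<le> t" "t + 2 \<le> (b + \<epsilon>) * R N" for t
    proof -
      have "real N / (K * C) * exp (- (q * ln (real N))) * p t
        \<le> prob {z \<in> space (log_gas \<alpha> V N). t < x_max N z \<and> x_max N z \<le> t + 2}"
        unfolding p_def
        using elim t by (intro log_gas_push_one_particle N M) auto
      also have "\<dots> \<le> p (t + 2)"
        unfolding p_def by (intro finite_measure_mono ev) auto
      also have "real N / (K * C) * exp (- (q * ln (real N))) = g"
        using N by (simp add: g_def powr_one_minus)
      finally show ?thesis .
    qed
    \<comment> \<open>Each push raises the level by 2; the final level stays below
      \<open>(b + \<epsilon>) * R N\<close> because \<open>2 * n\<close> is at most
      \<open>\<epsilon> * R N\<close>.\<close>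
    have "g ^ k * p (b * R N) \<le> p (b * R N + 2 * real k)" if "k \<le> n" for k
      using that
    proof (induction k)
      case (Suc k)
      have "g ^ Suc k * p (b * R N) \<le> g * p (b * R N + 2 * real k)"
        using Suc g by (simp add: mult.assoc mult_left_mono)
      also have "\<dots> \<le> p (b * R N + 2 * real k + 2)"
        using elim Suc.prems by (intro step) (auto simp: distrib_right)
      finally show ?case by (simp add: algebra_simps)
    qed simp
    \<comment> \<open>Bounding the last probability by 1 leaves the reciprocal of
      \<open>g ^ n\<close> as a bound for \<open>p (b * R N)\<close>.\<close>
    then have "g ^ n * p (b * R N) \<le> 1"
      using order_trans[OF _ prob_le_1] unfolding p_def by blast
    moreover have "g ^ n = real N powr ((1 - q) * real n) / (K * C) ^ n"
      using N by (simp add: g_def power_divide powr_power mult.commute)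
    ultimately have "p (b * R N) \<le> (K * C) ^ n * real N powr ((q - 1) * real n)"
      using K_pos C_pos N by (simp add: field_simps powr_minus[symmetric] powr_add powr_diff)
    also have "\<dots> \<le> real N powr (- s)" using elim by simp
    finally show ?case by (simp add: p_def)
  qed
qed

text \<open>For \<open>1 < x\<close> the upper tail bound makes
  \<open>x_max N z \<le> x * R N\<close> likely, so a single push starting from there yields mass
  \<open>N powr (1 - q)\<close> up to a constant, with \<open>q\<close> just above
  \<open>x powr d\<close>.\<close>

lemma interval_mass:
  assumes x: "1 < x" "x < x'" and s: "x powr d - 1 < s"
  shows "eventually (\<lambda>N. real N powr (- s) \<le>
    measure (log_gas \<alpha> V N) {z \<in> space (log_gas \<alpha> V N). x * R N < x_max N z \<and> x_max N z < x' * R N}) sequentially"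
proof -
  have "x powr d < s + 1" using s by simp
  then obtain q where q: "x powr d < q" "q < s + 1" using dense by blast
  obtain \<epsilon> M where \<epsilon>: "0 < \<epsilon>"
    and M: "\<And>N y. 1 \<le> N \<Longrightarrow> M \<le> y \<Longrightarrow> y \<le> (x + \<epsilon>) * R N \<Longrightarrow> V y \<le> q * ln (real N)"
    using potential_le_near_scale[of x q] x q by auto
  have "1 powr d < x powr d" using x d by (intro powr_less_mono2) auto
  then have x0: "0 < x powr d - 1" by simp
  then have s0: "(x powr d - 1) / 2 < x powr d - 1" "- ((x powr d - 1) / 2) < 0" by simp_all
  have qs: "- s < 1 - q" using q by simp
  have x_pos: "0 < x" "0 < x' - x" using x by simp_all
  \<comment> \<open>The 2 in the constant compensates for \<open>1 / 2 \<le> ?p\<close>. The margin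
    3 exceeds the reach 2 of a push, which gives the strict bound by
    \<open>x' * R N\<close>.\<close>
  from const_times_powr_le[OF qs, of "2 * (K * C)"] const_times_powr_le[OF s0(2), of 2]
    upper_tail_decay[OF x_pos(1) s0(1)]
    R_ge[OF x_pos(1), of "max 1 M"] R_ge[OF \<epsilon>, of 2] R_ge[OF x_pos(2), of 3]
    eventually_ge_at_top[of 1] eventually_ge_at_top[of "nat \<lceil>2 * \<alpha>\<rceil>"]
  show ?thesis
  proof eventually_elim
    case (elim N)
    have N: "1 \<le> N" "2 * \<alpha> \<le> real N" using elim by linarith+
    interpret prob_space "log_gas \<alpha> V N" using N by (rule prob_space_log_gas)
    let ?t = "x * R N"
    let ?p = "prob {z \<in> space (log_gas \<alpha> V N). x_max N z \<le> ?t}"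
    have ev: "{z \<in> space (log_gas \<alpha> V N). x_max N z \<le> ?t} \<in> events"
      "{z \<in> space (log_gas \<alpha> V N). ?t \<le> x_max N z} \<in> events"
      "{z \<in> space (log_gas \<alpha> V N). ?t < x_max N z \<and> x_max N z < x' * R N} \<in> events"
      unfolding space_log_gas sets_log_gas by measurable
    have "1 = prob ({z \<in> space (log_gas \<alpha> V N). x_max N z \<le> ?t} \<union> {z \<in> space (log_gas \<alpha> V N). ?t \<le> x_max N z})"
      by (subst prob_space[symmetric]) (auto intro!: arg_cong[where f=prob])
    also have "\<dots> \<le> ?p + prob {z \<in> space (log_gas \<alpha> V N). ?t \<le> x_max N z}"
      using ev by (intro measure_Un_le) auto
    also have "prob {z \<in> space (log_gas \<alpha> V N). ?t \<le> x_max N z} \<le> 1 / 2"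
      using elim N by simp
    finally have p: "1 / 2 \<le> ?p" by simp
    have "real N powr (- s) \<le> real N powr (1 - q) / (2 * (K * C))"
      using elim K_pos C_pos by (simp add: field_simps)
    also have "\<dots> = real N / (K * C) * exp (- (q * ln (real N))) * (1 / 2)"
      using N by (simp add: powr_one_minus)
    also have "\<dots> \<le> real N / (K * C) * exp (- (q * ln (real N))) * ?p"
      using K_pos C_pos by (intro mult_left_mono p) auto
    also have "\<dots> \<le> prob {z \<in> space (log_gas \<alpha> V N). ?t < x_max N z \<and> x_max N z \<le> ?t + 2}"
      using elim by (intro log_gas_push_one_particle N M) (auto simp: distrib_right)
    also have "\<dots> \<le> prob {z \<in> space (log_gas \<alpha> V N). ?t < x_max N z \<and> x_max N z < x' * R N}"
      using elim ev by (intro finite_measure_mono) (auto simp: left_diff_distrib)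
    finally show ?case .
  qed
qed

end

section \<open>The large deviation principle\<close>

text \<open>On \<open>{1..}\<close> the rate is continuous and increasing, and it is infinite
  elsewhere, so the nonempty level sets are bounded closed intervals starting at 1.\<close>

lemma good_rate_function_rate_I:
  assumes d: "1 \<le> d"
  shows "good_rate_function (rate_I d)"
  unfolding good_rate_function_def
proof (intro conjI allI)
  fix x :: real
  have "1 \<le> x powr d" if "1 \<le> x" using that d by (intro ge_one_powr_ge_zero) auto
  then show "0 \<le> rate_I d x" by (simp add: rate_I_def)
next
  fix x :: real
  show "rate_I d x \<le> Liminf (at x) (rate_I d)"
    unfolding le_Liminf_iff
  proof (intro allI impI)
    fix y assume y: "y < rate_I d x"
    show "eventually (\<lambda>z. y < rate_I d z) (at x)"
    proof (cases "1 \<le> x")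
      case False
      then have "eventually (\<lambda>z. z < 1) (at x)"
        by (intro order_tendstoD(2)[OF tendsto_ident_at]) auto
      then show ?thesis
        using y False by (auto elim!: eventually_mono simp: rate_I_def)
    next
      case True
      \<comment> \<open>The rate dominates this continuous function, being infinite to the left of
        1, so the boundary point 1 is covered together with the points above it.\<close>
      have "((\<lambda>z. ereal (z powr d - 1)) \<longlongrightarrow> ereal (x powr d - 1)) (at x)"
        using True by (intro tendsto_intros) auto
      then have "eventually (\<lambda>z. y < ereal (z powr d - 1)) (at x)"
        using y True by (intro order_tendstoD(1)) (auto simp: rate_I_def)
      then show ?thesis
        by (rule eventually_mono) (auto simp: rate_I_def)
    qed
  qed
next
  fix c :: real
  have "{x. rate_I d x \<le> ereal c} = (if c < 0 then {} else {1..(1 + c) powr (1 / d)})"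
  proof (cases "c < 0")
    case True
    have "1 \<le> x powr d" if "1 \<le> x" for x :: real using that d by (intro ge_one_powr_ge_zero) auto
    then show ?thesis using True by (force simp: rate_I_def)
  next
    case False
    have "x powr d - 1 \<le> c \<longleftrightarrow> x \<le> (1 + c) powr (1 / d)" if "1 \<le> x" for x :: real
    proof
      assume "x powr d - 1 \<le> c"
      then have "(x powr d) powr (1 / d) \<le> (1 + c) powr (1 / d)"
        using d by (intro powr_mono2) auto
      then show "x \<le> (1 + c) powr (1 / d)" using d that by (simp add: powr_powr)
    next
      assume "x \<le> (1 + c) powr (1 / d)"
      then have "x powr d \<le> ((1 + c) powr (1 / d)) powr d"
        using d that by (intro powr_mono2) auto
      then show "x powr d - 1 \<le> c" using d False by (simp add: powr_powr)
    qed
    then show ?thesis using False by (auto simp: rate_I_def)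
  qed
  then show "compact {x. rate_I d x \<le> ereal c}" by simp
qed

section \<open>Passage from powers of N to the logarithmic scale\<close>

lemma scaled_log_prob_le:
  assumes "1 < n" "0 \<le> p" "p \<le> n powr (- s)"
  shows "ereal (1 / ln n) * log_prob p \<le> ereal (- s)"
proof (cases "p = 0")
  case False
  then have "ln p \<le> ln (n powr (- s))" using assms by (intro ln_mono) auto
  then have "ln p \<le> - s * ln n" using assms by (simp add: ln_powr)
  then have "1 / ln n * ln p \<le> - s" using assms by (simp add: field_simps)
  then show ?thesis using False by (simp add: log_prob_def)
qed (use assms in \<open>simp add: log_prob_def\<close>)

lemma scaled_log_prob_ge:
  assumes "1 < n" "n powr (- s) \<le> p"
  shows "ereal (- s) \<le> ereal (1 / ln n) * log_prob p"
proof -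
  have p: "0 < p" using assms by (intro less_le_trans[OF _ assms(2)]) simp
  have "ln (n powr (- s)) \<le> ln p" using assms p by (intro ln_mono) auto
  then have "- s * ln n \<le> ln p" using assms by (simp add: ln_powr)
  then have "- s \<le> 1 / ln n * ln p" using assms by (simp add: field_simps)
  then show ?thesis using p by (simp add: log_prob_def)
qed

text \<open>The tail properties from which the principle follows. In \<open>lower\<close> the
  exponent \<open>s\<close> is arbitrary, which expresses the infinite rate below 1, while
  \<open>upper\<close> and \<open>mass\<close> approach the exponent \<open>x powr d - 1\<close>
  from opposite sides.\<close>

locale log_scale_tails =
  fixes \<mu> :: "nat \<Rightarrow> real measure" and d :: real
  assumes d: "1 \<le> d"
    and prob: "eventually (\<lambda>N. prob_space (\<mu> N) \<and> sets (\<mu> N) = sets borel) sequentially"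
    and lower: "\<And>b s. 0 < b \<Longrightarrow> b < 1 \<Longrightarrow>
      eventually (\<lambda>N. measure (\<mu> N) {..b} \<le> real N powr (- s)) sequentially"
    and upper: "\<And>x s. 0 < x \<Longrightarrow> s < x powr d - 1 \<Longrightarrow>
      eventually (\<lambda>N. measure (\<mu> N) {x..} \<le> real N powr (- s)) sequentially"
    and mass: "\<And>x x' s. 1 < x \<Longrightarrow> x < x' \<Longrightarrow> x powr d - 1 < s \<Longrightarrow>
      eventually (\<lambda>N. real N powr (- s) \<le> measure (\<mu> N) {x<..<x'}) sequentially"
begin

text \<open>Since \<open>rate_I d 1 = 0\<close>, a closed set on which the infimum of the rate is
  positive misses a neighbourhood of 1. It is covered by a half-line below some \<open>b < 1\<close>
  and the half-line above the point where the rate takes a value between \<open>s\<close> and the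
  infimum. For \<open>s < 0\<close> the bound exceeds 1.\<close>

lemma closed_set_mass:
  assumes F: "closed F" and s: "ereal s < (INF x\<in>F. rate_I d x)"
  shows "eventually (\<lambda>N. measure (\<mu> N) F \<le> real N powr (- s)) sequentially"
proof (cases "s < 0")
  case True
  from prob eventually_ge_at_top[of 1] show ?thesis
  proof eventually_elim
    case (elim N)
    then interpret prob_space "\<mu> N" by simp
    have "measure (\<mu> N) F \<le> 1" by simp
    also have "\<dots> \<le> real N powr (- s)" using elim True by (intro ge_one_powr_ge_zero) auto
    finally show ?case .
  qed
next
  case False
  \<comment> \<open>Passing to \<open>s'\<close> gives a strictly positive level even when
    \<open>s = 0\<close>, and room to absorb the factor 2 from the union of the two
    half-lines.\<close>
  obtain s' where s': "ereal s < ereal s'" "ereal s' < (INF x\<in>F. rate_I d x)"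
    using ereal_dense2[OF s] by blast
  define x where "x = (s' + 1) powr (1 / d)"
  have s'_pos: "0 < s'" using s' False by simp
  have x: "0 < x" "x powr d - 1 = s'"
    using s'_pos d by (auto simp: x_def powr_powr)
  have I: "ereal s' < rate_I d y" if "y \<in> F" for y
    using s'(2) that by (meson INF_lower less_le_trans)
  have "1 \<notin> F" using I[of 1] s'_pos by (auto simp: rate_I_def)
  then obtain e where e: "0 < e" "ball 1 e \<subseteq> - F"
    using F by (metis ComplI open_Compl open_contains_ball)
  \<comment> \<open>The value \<open>1 / 2\<close> keeps \<open>b\<close> positive, as
    \<open>lower\<close> requires, when \<open>e\<close> is large.\<close>
  define b where "b = max (1 / 2) (1 - e / 2)"
  have b: "0 < b" "b < 1" using e by (auto simp: b_def)
  have sub: "F \<subseteq> {..b} \<union> {x..}"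
  proof
    fix y assume y: "y \<in> F"
    show "y \<in> {..b} \<union> {x..}"
    proof (cases "1 \<le> y")
      case True
      then have "s' < y powr d - 1" using I[OF y] by (simp add: rate_I_def)
      then have "x powr d < y powr d" using x by simp
      then have "\<not> y < x" using True d powr_mono2[of d y x] by auto
      then show ?thesis by simp
    next
      case False
      have "y \<notin> ball 1 e" using y e by blast
      then show ?thesis using False by (auto simp: b_def dist_real_def)
    qed
  qed
  define r where "r = (s + s') / 2"
  have r: "- r < - s" "r < x powr d - 1" using s' x by (auto simp: r_def)
  have "((\<lambda>N. 2 * real N powr (s - r)) \<longlongrightarrow> 0) sequentially" using r by real_asymp
  then have "eventually (\<lambda>N. 2 * real N powr (s - r) < 1) sequentially"
    by (rule order_tendstoD) simp
  with prob lower[OF b, of r] upper[OF x(1) r(2)] eventually_ge_at_top[of 1]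
  show ?thesis
  proof eventually_elim
    case (elim N)
    then interpret prob_space "\<mu> N" by simp
    have sets: "sets (\<mu> N) = sets borel" using elim by simp
    have "prob F \<le> prob ({..b} \<union> {x..})"
      using sub by (intro finite_measure_mono) (auto simp: sets)
    also have "\<dots> \<le> prob {..b} + prob {x..}"
      by (intro measure_Un_le) (auto simp: sets)
    also have "\<dots> \<le> 2 * real N powr (- r)" using elim by simp
    also have "\<dots> = 2 * real N powr (s - r) * real N powr (- s)"
      by (simp flip: powr_add)
    also have "\<dots> \<le> 1 * real N powr (- s)"
      using elim by (intro mult_right_mono) auto
    finally show ?case by simp
  qed
qed

text \<open>\<open>mass\<close> applies strictly to the right of 1 and to intervals that start at
  the given point. Moving slightly to the right inside \<open>U\<close> keeps the exponent below
  \<open>s\<close> and includes the case \<open>x = 1\<close>.\<close>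

lemma open_set_mass:
  assumes U: "open U" "x \<in> U" "1 \<le> x" and s: "x powr d - 1 < s"
  shows "eventually (\<lambda>N. real N powr (- s) \<le> measure (\<mu> N) U) sequentially"
proof -
  have "((\<lambda>z. z powr d - 1) \<longlongrightarrow> x powr d - 1) (at_right x)"
    using U by (intro tendsto_intros) auto
  then have "eventually (\<lambda>z. z powr d - 1 < s) (at_right x)"
    using s by (rule order_tendstoD)
  moreover have "eventually (\<lambda>z. z \<in> U) (at_right x)"
    using U by (intro topological_tendstoD[OF tendsto_ident_at])
  moreover have "eventually (\<lambda>z. x < z) (at_right x)" by (rule eventually_at_right_less)
  ultimately have "eventually (\<lambda>z. z powr d - 1 < s \<and> z \<in> U \<and> x < z) (at_right x)"
    by (intro eventually_conj)
  then obtain z where z: "z powr d - 1 < s" "z \<in> U" "x < z"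
    using eventually_happens'[OF trivial_limit_at_right_real] by blast
  obtain e where e: "0 < e" "ball z e \<subseteq> U" using U z by (meson openE)
  have sub: "{z<..<z + e} \<subseteq> U" using e by (auto simp: dist_real_def subset_iff)
  have "1 < z" "z < z + e" using z U e by auto
  from prob mass[OF this z(1)] show ?thesis
  proof eventually_elim
    case (elim N)
    then interpret prob_space "\<mu> N" by simp
    have "prob {z<..<z + e} \<le> prob U"
      using sub U elim by (intro finite_measure_mono) auto
    then show ?case using elim by simp
  qed
qed

text \<open>For an open set every point of finite rate gives a lower bound, and points below 1
  impose no condition. For a closed set every level below the infimum gives an upper bound; density
  of the reals in \<open>ereal\<close> also covers an infinite infimum.\<close>

lemma large_deviation_principle_rate_I:
  "large_deviation_principle \<mu> (\<lambda>N. ln (real N)) (rate_I d)"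
  unfolding large_deviation_principle_def
proof (intro conjI allI impI)
  fix U :: "real set" assume U: "open U"
  let ?L = "liminf (\<lambda>N. ereal (1 / ln (real N)) * log_prob (measure (\<mu> N) U))"
  have "- ?L \<le> (INF x\<in>U. rate_I d x)"
  proof (intro INF_greatest)
    fix x assume x: "x \<in> U"
    show "- ?L \<le> rate_I d x"
    proof (cases "1 \<le> x")
      case True
      have *: "- ?L \<le> ereal s" if "x powr d - 1 < s" for s
      proof -
        have "ereal (- s) \<le> ?L"
        proof (intro Liminf_bounded)
          from open_set_mass[OF U x True that] eventually_gt_at_top[of 1]
          show "eventually (\<lambda>N. ereal (- s) \<le> ereal (1 / ln (real N)) * log_prob (measure (\<mu> N) U)) sequentially"
            by eventually_elim (auto intro: scaled_log_prob_ge)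
        qed
        then show ?thesis by (metis ereal_uminus_le_reorder uminus_ereal.simps(1))
      qed
      have "- ?L \<le> ereal (x powr d - 1)"
      proof (rule dense_ge)
        fix y assume "ereal (x powr d - 1) < y"
        then obtain s where "ereal (x powr d - 1) < ereal s" "ereal s < y"
          using ereal_dense2 by blast
        then show "- ?L \<le> y" using *[of s] by auto
      qed
      then show ?thesis using True by (simp add: rate_I_def)
    qed (simp add: rate_I_def)
  qed
  then show "- (INF x\<in>U. rate_I d x) \<le> ?L"
    by (simp add: ereal_uminus_le_reorder)
next
  fix F :: "real set" assume F: "closed F"
  let ?L = "limsup (\<lambda>N. ereal (1 / ln (real N)) * log_prob (measure (\<mu> N) F))"
  show "?L \<le> - (INF x\<in>F. rate_I d x)"
  proof (rule dense_ge)
    fix y assume "- (INF x\<in>F. rate_I d x) < y"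
    then obtain r where r: "- (INF x\<in>F. rate_I d x) < ereal r" "ereal r < y"
      using ereal_dense2 by blast
    then have "ereal (- r) < (INF x\<in>F. rate_I d x)"
      by (metis ereal_uminus_less_reorder uminus_ereal.simps(1))
    from closed_set_mass[OF F this] eventually_gt_at_top[of 1]
    have "eventually (\<lambda>N. ereal (1 / ln (real N)) * log_prob (measure (\<mu> N) F) \<le> ereal (- (- r))) sequentially"
      by eventually_elim (auto intro!: scaled_log_prob_le simp del: minus_minus)
    then have "?L \<le> ereal r" by (intro Limsup_bounded) simp
    then show "?L \<le> y" using r by simp
  qed
qed

end

section \<open>Verification of the tail properties for the log-gas\<close>

lemma (in log_gas_asymptotics) log_scale_tails_scaled_x_max_law:
  "log_scale_tails (scaled_x_max_law d \<theta> \<alpha> V) d"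
proof
  \<comment> \<open>\<open>0 < R N\<close> fails at \<open>N = 1\<close>; it serves to turn bounds
    on \<open>x_max N z / R N\<close> into bounds on \<open>x_max N z\<close>.\<close>
  define good where "good N \<longleftrightarrow> 1 \<le> N \<and> 2 * \<alpha> \<le> real N \<and> 0 < R N" for N
  have good: "eventually good sequentially"
    unfolding good_def
    using eventually_ge_at_top[of 1] eventually_ge_at_top[of "nat \<lceil>2 * \<alpha>\<rceil>"]
      filterlim_at_top_dense[THEN iffD1, OF R_at_top, rule_format, of 0]
    by eventually_elim linarith
  have scaled: "scaled_x_max d \<theta> N z = x_max N z / R N" for N z
    by (simp add: scaled_x_max_def R_def)
  have meas: "scaled_x_max d \<theta> N \<in> log_gas \<alpha> V N \<rightarrow>\<^sub>M borel" for N
    unfolding scaled_x_max_def[abs_def] measurable_cong_sets[OF sets_log_gas refl] by measurable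
  have law: "measure (scaled_x_max_law d \<theta> \<alpha> V N) A =
     measure (log_gas \<alpha> V N) {z \<in> space (log_gas \<alpha> V N). x_max N z / R N \<in> A}" if "A \<in> sets borel" for A N
    unfolding scaled_x_max_law_def using meas that
    by (subst measure_distr) (auto simp: scaled vimage_def Int_def conj_commute)
  show "1 \<le> d" by (rule d)
  show "eventually (\<lambda>N. prob_space (scaled_x_max_law d \<theta> \<alpha> V N) \<and>
      sets (scaled_x_max_law d \<theta> \<alpha> V N) = sets borel) sequentially"
    using good
  proof eventually_elim
    case (elim N)
    then interpret prob_space "log_gas \<alpha> V N" by (intro prob_space_log_gas) (auto simp: good_def)
    show ?case using prob_space_distr[OF meas] by (simp add: scaled_x_max_law_def)
  qed
  show "eventually (\<lambda>N. measure (scaled_x_max_law d \<theta> \<alpha> V N) {..b} \<le> real N powr (- s)) sequentially"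
    if "0 < b" "b < 1" for b s
    using lower_tail_decay[OF that, of s] good
    by eventually_elim (simp add: law good_def pos_divide_le_eq)
  show "eventually (\<lambda>N. measure (scaled_x_max_law d \<theta> \<alpha> V N) {x..} \<le> real N powr (- s)) sequentially"
    if "0 < x" "s < x powr d - 1" for x s
    using upper_tail_decay[OF that] good
    by eventually_elim (simp add: law good_def pos_le_divide_eq)
  show "eventually (\<lambda>N. real N powr (- s) \<le> measure (scaled_x_max_law d \<theta> \<alpha> V N) {x<..<x'}) sequentially"
    if "1 < x" "x < x'" "x powr d - 1 < s" for x x' s
    using interval_mass[OF that] good
    by eventually_elim (simp add: law good_def pos_less_divide_eq pos_divide_less_eq)
qed

text \<open>Continuity on the compact interval \<open>{0..1}\<close> yields
  \<open>c = exp (- b)\<close> with \<open>b\<close> a bound for \<open>|V|\<close> there;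
  \<open>C\<close> comes from the moment bound with \<open>\<kappa> = 1\<close>.\<close>

lemma admissible_potential_log_gas_asymptotics:
  assumes \<alpha>: "0 < \<alpha>" and V: "admissible_potential d \<theta> V"
  obtains c C where "log_gas_asymptotics V \<alpha> c C d \<theta>"
proof -
  have cont: "continuous_on UNIV V" using V by (simp add: admissible_potential_def)
  have "compact (V ` {0..1})"
    by (intro compact_continuous_image continuous_on_subset[OF cont]) auto
  then have "bounded (V ` {0..1})" by (rule compact_imp_bounded)
  then obtain b where b: "\<And>y. y \<in> {0..1} \<Longrightarrow> \<bar>V y\<bar> \<le> b"
    unfolding bounded_iff by fastforce
  obtain C where C: "0 < C"
    "(\<integral>\<^sup>+y. ennreal (exp (- (1 * V y)) * (1 + \<bar>y\<bar>) powr (2 * \<alpha> + 1)) \<partial>lborel) \<le> ennreal C"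
    using admissible_potential_moment[OF V zero_less_one] by blast
  have "log_gas_asymptotics V \<alpha> (exp (- b)) C d \<theta>"
  proof
    show "V \<in> borel_measurable borel" using cont by (rule borel_measurable_continuous_onI)
    show "exp (- b) \<le> exp (- V y)" if "0 \<le> y" "y \<le> 1" for y using b[of y] that by auto
  qed (use \<alpha> V C in auto)
  then show thesis by (rule that)
qed

theorem theorem1p2:
  fixes V :: "real \<Rightarrow> real" and d \<theta> \<alpha> :: real
  assumes "\<alpha> > 0"
    and "admissible_potential d \<theta> V"
  shows "good_rate_function (rate_I d) \<and>
         large_deviation_principle (scaled_x_max_law d \<theta> \<alpha> V) (\<lambda>N. ln (real N)) (rate_I d)"
proof -
  obtain c C where "log_gas_asymptotics V \<alpha> c C d \<theta>"
    using admissible_potential_log_gas_asymptotics[OF assms] .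
  then interpret log_gas_asymptotics V \<alpha> c C d \<theta> .
  interpret log_scale_tails "scaled_x_max_law d \<theta> \<alpha> V" d
    by (rule log_scale_tails_scaled_x_max_law)
  show ?thesis
    using good_rate_function_rate_I[OF d] large_deviation_principle_rate_I by blast
qed

end
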